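(* Let $\mathbf T$ be a nominal transition system with a nominal set $\mathcal F$ of effects and an equivariant function $L\colon\mathrm{ACT}\times\mathcal P_{\mathrm{fs}}(\mathcal F)\times\mathcal F\to\mathcal P_{\mathrm{fs}}(\mathcal F)$. For every $F\in\mathcal P_{\mathrm{fs}}(\mathcal F)$ and all states $P,Q$: $P\stackrel{F/L}{\sim}Q$ if and only if $P$ and $Q$ satisfy the same formulas in $\mathcal A^{F/L}$.
   Context: Nominal sets over a countably infinite (possibly sorted) set of names $\mathcal N$: permutations fix all but finitely many names; each element has finite support $\operatorname{supp}$; $a\# X$ means $a\notin\operatorname{supp}(X)$, and $N\# X,Y$ means every $a\in N$ is fresh for $X$ and $Y$; equivariant = fixed by all permutations; $[\mathcal P_{\mathrm{fin}}(\mathcal N)]S$ is $\mathcal P_{\mathrm{fin}}(\mathcal N)\times S$ modulo $(N,X)=_\alpha(N',X')$ iff some $\pi$ with $\pi\cdot(N,X)=(N',X')$ fixes every name of $\operatorname{supp}(X)\setminus N$; classes $\langle N\rangle X$. A nominal transition system: nominal sets STATES, PRED, ACT; equivariant $\vdash\subseteq\mathrm{STATES}\times\mathrm{PRED}$; equivariant $\operatorname{bn}$, $\operatorname{bn}(\alpha)$ a finite subset of $\operatorname{supp}(\alpha)$; equivariant $\rightarrow\ \subseteq\mathrm{STATES}\times[\mathcal P_{\mathrm{fin}}(\mathcal N)](\mathrm{ACT}\times\mathrm{STATES})$ with $(P,\langle N\rangle(\alpha,Q))\in\rightarrow$ only if $N=\operatorname{bn}(\alpha)$; $P\xrightarrow{\alpha}P'$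 means $(P,\langle\operatorname{bn}(\alpha)\rangle(\alpha,P'))\in\rightarrow$. An effect is a finitely supported function from states to states; $\mathcal F$ is a nominal set of effects and $\mathcal P_{\mathrm{fs}}(\mathcal F)$ the set of its finitely supported subsets. An $L$-bisimulation is a $\mathcal P_{\mathrm{fs}}(\mathcal F)$-indexed family $\{R_F\}$ of symmetric binary relations on states such that for all $F$, $R_F(P,Q)$ implies: (1) for all $f\in F$ and $\varphi$, $f(P)\vdash\varphi$ implies $f(Q)\vdash\varphi$; (2) for all $f\in F$ and $\alpha,P'$ with $\operatorname{bn}(\alpha)\# f(Q),F,f$: if $f(P)\xrightarrow{\alpha}P'$ then there is $Q'$ with $f(Q)\xrightarrow{\alpha}Q'$ and $R_{L(\alpha,F,f)}(P',Q')$. $P\stackrel{F/L}{\sim}Q$ iff there is an $L$-bisimulation $\{R_F\}$ with $R_F(P,Q)$. Formulas: fix an infinite cardinal $\kappa>\aleph_0$ with $\kappa>|\mathrm{STATES}|$. The sets $\mathcal A^{F/L}$ ($F\in\mathcal P_{\mathrm{fs}}(\mathcal F)$) are defined by simultaneous induction: $\bigwedge_{i\in I}A_i\in\mathcal A^{F/L}$ whenever all $A_i\in\mathcal A^{F/L}$ and $\{A_i\mid i\in I\}$ has cardinality $<\kappa$ and finite support; $\neg A\in\mathcal A^{F/L}$ for $A\in\mathcal A^{F/L}$; $\langle f\rangle\varphi\in\mathcal A^{F/L}$ for $f\in F$, $\varphi\in\mathrm{PRED}$; $\langle f\rangle\langle\alpha\rangle A\in\mathcal A^{F/L}$ for $f\in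 F$, $\operatorname{bn}(\alpha)\# f,F$ and $A\in\mathcal A^{L(\alpha,F,f)/L}$, where $\operatorname{bn}(\alpha)$ is bound in $\alpha$ and $A$ (the modality denotes an alpha-equivalence class). Satisfaction: $P\models\bigwedge A_i$ iff all $P\models A_i$; $P\models\neg A$ iff not $P\models A$; $P\models\varphi$ iff $P\vdash\varphi$; $P\models\langle f\rangle A$ iff $f(P)\models A$; $P\models\langle\alpha\rangle A$ iff, for a representative with $\operatorname{bn}(\alpha)$ fresh for $P$ (and for $F,f$), there is $P'$ with $P\xrightarrow{\alpha}P'$ and $P'\models A$. *)

theory Defs
  imports "HOL-Combinatorics.Perm" "HOL-Library.Countable_Set_Type"
begin

unbundle cardinal_syntax
notation "apply" (infixl \<open>\<langle>$\<rangle>\<close> 999)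

section \<open>Nominal sets\<close>

text \<open>
  Names are the elements of a type \<open>'n\<close>, sorted by a function \<open>srt\<close>; the unsorted case is a
  constant \<open>srt\<close>. The type \<open>'n perm\<close> consists of the bijections that fix all but finitely
  many names, and only the sort-respecting ones act.
\<close>

definition name_supply :: "('n \<Rightarrow> 't) \<Rightarrow> bool" where
  "name_supply srt \<longleftrightarrow> countable (UNIV :: 'n set) \<and> (\<forall>a. infinite {b. srt b = srt a})"

definition perms :: "('n \<Rightarrow> 't) \<Rightarrow> 'n perm set" where
  "perms srt = {\<pi>. \<forall>a. srt (\<pi> \<langle>$\<rangle> a) = srt a}"

type_synonym ('n, 'x) action = "'n perm \<Rightarrow> 'x \<Rightarrow> 'x"

definition act_pair :: "('n, 'x) action \<Rightarrow> ('n, 'y) action \<Rightarrow> ('n, 'x \<times> 'y) action" where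
  "act_pair p q \<pi> = map_prod (p \<pi>) (q \<pi>)"

definition act_set :: "('n, 'x) action \<Rightarrow> ('n, 'x set) action" where
  "act_set p \<pi> X = p \<pi> ` X"

definition act_fun :: "('n, 'x) action \<Rightarrow> ('n, 'y) action \<Rightarrow> ('n, 'x \<Rightarrow> 'y) action" where
  "act_fun p q \<pi> f = q \<pi> \<circ> f \<circ> p (inverse \<pi>)"

definition act_names :: "('n, 'n set) action" where
  "act_names = act_set (\<langle>$\<rangle>)"

definition equivariant :: "('n \<Rightarrow> 't) \<Rightarrow> ('n, 'x) action \<Rightarrow> 'x \<Rightarrow> bool" where
  "equivariant srt p x \<longleftrightarrow> (\<forall>\<pi> \<in> perms srt. p \<pi> x = x)"

definition supports :: "('n \<Rightarrow> 't) \<Rightarrow> ('n, 'x) action \<Rightarrow> 'n set \<Rightarrow> 'x \<Rightarrow> bool" where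
  "supports srt p N x \<longleftrightarrow> (\<forall>\<pi> \<in> perms srt. (\<forall>a \<in> N. \<pi> \<langle>$\<rangle> a = a) \<longrightarrow> p \<pi> x = x)"

definition finitely_supported :: "('n \<Rightarrow> 't) \<Rightarrow> ('n, 'x) action \<Rightarrow> 'x \<Rightarrow> bool" where
  "finitely_supported srt p x \<longleftrightarrow> (\<exists>N. finite N \<and> supports srt p N x)"

text \<open>For a finitely supported element this is its least finite supporting set.\<close>

definition supp :: "('n \<Rightarrow> 't) \<Rightarrow> ('n, 'x) action \<Rightarrow> 'x \<Rightarrow> 'n set" where
  "supp srt p x = \<Inter>{N. finite N \<and> supports srt p N x}"

definition fresh :: "('n \<Rightarrow> 't) \<Rightarrow> ('n, 'x) action \<Rightarrow> 'n set \<Rightarrow> 'x \<Rightarrow> bool" where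
  "fresh srt p N x \<longleftrightarrow> (\<forall>a \<in> N. a \<notin> supp srt p x)"

definition nominal_set :: "('n \<Rightarrow> 't) \<Rightarrow> ('n, 'x) action \<Rightarrow> 'x set \<Rightarrow> bool" where
  "nominal_set srt p X \<longleftrightarrow>
     (\<forall>x \<in> X. p 1 x = x) \<and>
     (\<forall>\<pi> \<in> perms srt. \<forall>x \<in> X. p \<pi> x \<in> X) \<and>
     (\<forall>\<pi> \<in> perms srt. \<forall>\<sigma> \<in> perms srt. \<forall>x \<in> X. p (\<pi> * \<sigma>) x = p \<pi> (p \<sigma> x)) \<and>
     (\<forall>x \<in> X. finitely_supported srt p x)"

definition alpha_eq ::
  "('n \<Rightarrow> 't) \<Rightarrow> ('n, 'x) action \<Rightarrow> 'n set \<times> 'x \<Rightarrow> 'n set \<times> 'x \<Rightarrow> bool" where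
  "alpha_eq srt p NX NX' \<longleftrightarrow>
     (\<exists>\<pi> \<in> perms srt. act_pair act_names p \<pi> NX = NX' \<and>
        (\<forall>a \<in> supp srt p (snd NX) - fst NX. \<pi> \<langle>$\<rangle> a = a))"

definition alpha_class ::
  "('n \<Rightarrow> 't) \<Rightarrow> ('n, 'x) action \<Rightarrow> 'n set \<Rightarrow> 'x \<Rightarrow> ('n set \<times> 'x) set" where
  "alpha_class srt p N x = {NX. alpha_eq srt p (N, x) NX}"


section \<open>Nominal transition systems\<close>

record ('n, 't, 's, 'p, 'a) nts =
  name_sort :: "'n \<Rightarrow> 't"
  perm_state :: "('n, 's) action"
  perm_pred :: "('n, 'p) action"
  perm_act :: "('n, 'a) action"
  models :: "('s \<times> 'p) set"
  bn :: "'a \<Rightarrow> 'n set"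
  transitions :: "('s \<times> ('n set \<times> 'a \<times> 's) set) set"

definition act_residual :: "('n, 't, 's, 'p, 'a) nts \<Rightarrow> ('n, 'a \<times> 's) action" where
  "act_residual T = act_pair (perm_act T) (perm_state T)"

definition residual ::
  "('n, 't, 's, 'p, 'a) nts \<Rightarrow> 'n set \<Rightarrow> 'a \<times> 's \<Rightarrow> ('n set \<times> 'a \<times> 's) set" where
  "residual T = alpha_class (name_sort T) (act_residual T)"

definition nominal_transition_system :: "('n, 't, 's, 'p, 'a) nts \<Rightarrow> bool" where
  "nominal_transition_system T \<longleftrightarrow>
     name_supply (name_sort T) \<and>
     nominal_set (name_sort T) (perm_state T) UNIV \<and>
     nominal_set (name_sort T) (perm_pred T) UNIV \<and>
     nominal_set (name_sort T) (perm_act T) UNIV \<and>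
     equivariant (name_sort T) (act_set (act_pair (perm_state T) (perm_pred T))) (models T) \<and>
     equivariant (name_sort T) (act_fun (perm_act T) act_names) (bn T) \<and>
     (\<forall>\<alpha>. finite (bn T \<alpha>) \<and> bn T \<alpha> \<subseteq> supp (name_sort T) (perm_act T) \<alpha>) \<and>
     transitions T \<subseteq> UNIV \<times> {residual T N (\<alpha>, Q) | N \<alpha> Q. finite N} \<and>
     equivariant (name_sort T)
       (act_set (act_pair (perm_state T) (act_set (act_pair act_names (act_residual T)))))
       (transitions T) \<and>
     (\<forall>P N \<alpha> Q. finite N \<longrightarrow> (P, residual T N (\<alpha>, Q)) \<in> transitions T \<longrightarrow> N = bn T \<alpha>)"

definition step :: "('n, 't, 's, 'p, 'a) nts \<Rightarrow> 's \<Rightarrow> 'a \<Rightarrow> 's \<Rightarrow> bool" where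
  "step T P \<alpha> P' \<longleftrightarrow> (P, residual T (bn T \<alpha>) (\<alpha>, P')) \<in> transitions T"


section \<open>Effects and L-bisimilarity\<close>

type_synonym 's effect = "'s \<Rightarrow> 's"

definition act_effect :: "('n, 't, 's, 'p, 'a) nts \<Rightarrow> ('n, 's effect) action" where
  "act_effect T = act_fun (perm_state T) (perm_state T)"

definition effect_set :: "('n, 't, 's, 'p, 'a) nts \<Rightarrow> 's effect set \<Rightarrow> bool" where
  "effect_set T \<F> \<longleftrightarrow> nominal_set (name_sort T) (act_effect T) \<F>"

definition Pow_fs :: "('n, 't, 's, 'p, 'a) nts \<Rightarrow> 's effect set \<Rightarrow> 's effect set set" where
  "Pow_fs T \<F> = {F. F \<subseteq> \<F> \<and> finitely_supported (name_sort T) (act_set (act_effect T)) F}"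

type_synonym ('s, 'a) effect_map = "'a \<Rightarrow> 's effect set \<Rightarrow> 's effect \<Rightarrow> 's effect set"

definition equivariant_effect_map ::
  "('n, 't, 's, 'p, 'a) nts \<Rightarrow> 's effect set \<Rightarrow> ('s, 'a) effect_map \<Rightarrow> bool" where
  "equivariant_effect_map T \<F> L \<longleftrightarrow>
     (\<forall>\<alpha>. \<forall>F \<in> Pow_fs T \<F>. \<forall>f \<in> \<F>. L \<alpha> F f \<in> Pow_fs T \<F> \<and>
        (\<forall>\<pi> \<in> perms (name_sort T).
           L (perm_act T \<pi> \<alpha>) (act_set (act_effect T) \<pi> F) (act_effect T \<pi> f) =
             act_set (act_effect T) \<pi> (L \<alpha> F f)))"

definition bn_fresh ::
  "('n, 't, 's, 'p, 'a) nts \<Rightarrow> 'a \<Rightarrow> 's effect set \<Rightarrow> 's effect \<Rightarrow> bool" where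
  "bn_fresh T \<alpha> F f \<longleftrightarrow>
     fresh (name_sort T) (act_set (act_effect T)) (bn T \<alpha>) F \<and>
     fresh (name_sort T) (act_effect T) (bn T \<alpha>) f"

definition L_bisimulation ::
  "('n, 't, 's, 'p, 'a) nts \<Rightarrow> 's effect set \<Rightarrow> ('s, 'a) effect_map \<Rightarrow>
     ('s effect set \<Rightarrow> 's \<Rightarrow> 's \<Rightarrow> bool) \<Rightarrow> bool" where
  "L_bisimulation T \<F> L R \<longleftrightarrow>
     (\<forall>F \<in> Pow_fs T \<F>. symp (R F) \<and>
       (\<forall>P Q. R F P Q \<longrightarrow>
         (\<forall>f \<in> F. \<forall>\<phi>. (f P, \<phi>) \<in> models T \<longrightarrow> (f Q, \<phi>) \<in> models T) \<and>
         (\<forall>f \<in> F. \<forall>\<alpha> P'.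
            fresh (name_sort T) (perm_state T) (bn T \<alpha>) (f Q) \<longrightarrow> bn_fresh T \<alpha> F f \<longrightarrow>
            step T (f P) \<alpha> P' \<longrightarrow>
            (\<exists>Q'. step T (f Q) \<alpha> Q' \<and> R (L \<alpha> F f) P' Q'))))"

definition L_bisimilar ::
  "('n, 't, 's, 'p, 'a) nts \<Rightarrow> 's effect set \<Rightarrow> ('s, 'a) effect_map \<Rightarrow>
     's effect set \<Rightarrow> 's \<Rightarrow> 's \<Rightarrow> bool" where
  "L_bisimilar T \<F> L F P Q \<longleftrightarrow> (\<exists>R. L_bisimulation T \<F> L R \<and> R F P Q)"


section \<open>Formulas\<close>

text \<open>
  A conjunction is determined by the set of its conjuncts, and \<open>\<langle>f\<rangle>\<langle>\<alpha>\<rangle>A\<close> by \<open>f\<close> and the alpha-class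
  of \<open>(\<alpha>, A)\<close> with \<open>bn \<alpha>\<close> bound. Both are made literal equalities between elements of one
  datatype, whose constructors \<open>Conj_raw\<close> and \<open>Mod_raw\<close> are not used directly:
  \<^item> a set of conjuncts is stored as a partial function on \<open>'k\<close> having this set as its range, one
    chosen for each set (\<open>Conj\<close>); the type \<open>'k\<close> carries the cardinal bounding conjunctions, so
    that every admissible set is stored faithfully (\<open>Conj_inject\<close>);
  \<^item> the abstraction class of \<open>(bn \<alpha>, (\<alpha>, A))\<close> is stored as a countable set (\<open>Mod\<close>); it is countable since
    there are countably many permutations of countably many names (\<open>countable_alpha_class\<close>).
\<close>

datatype ('k, 'n, 's, 'p, 'a) formula =
    Conj_raw "'k \<Rightarrow> ('k, 'n, 's, 'p, 'a) formula option"
  | Neg "('k, 'n, 's, 'p, 'a) formula"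
  | Eff_Pred "'s effect" 'p
  | Mod_raw "'s effect" "('n set \<times> 'a \<times> ('k, 'n, 's, 'p, 'a) formula) cset"

definition Conj ::
  "('k, 'n, 's, 'p, 'a) formula set \<Rightarrow> ('k, 'n, 's, 'p, 'a) formula" where
  "Conj S = Conj_raw (SOME m. ran m = S)"

primrec perm_formula ::
  "('n, 't, 's, 'p, 'a) nts \<Rightarrow> 'n perm \<Rightarrow>
     ('k, 'n, 's, 'p, 'a) formula \<Rightarrow> ('k, 'n, 's, 'p, 'a) formula" where
  "perm_formula T \<pi> (Conj_raw m) = Conj (ran (map_option (perm_formula T \<pi>) \<circ> m))"
| "perm_formula T \<pi> (Neg A) = Neg (perm_formula T \<pi> A)"
| "perm_formula T \<pi> (Eff_Pred f \<phi>) = Eff_Pred (act_effect T \<pi> f) (perm_pred T \<pi> \<phi>)"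
| "perm_formula T \<pi> (Mod_raw f C) = Mod_raw (act_effect T \<pi> f)
     (cimage (map_prod (act_names \<pi>) (map_prod (perm_act T \<pi>) (perm_formula T \<pi>))) C)"

definition Mod ::
  "('n, 't, 's, 'p, 'a) nts \<Rightarrow> 's effect \<Rightarrow> 'a \<Rightarrow>
     ('k, 'n, 's, 'p, 'a) formula \<Rightarrow> ('k, 'n, 's, 'p, 'a) formula" where
  "Mod T f \<alpha> A = Mod_raw f (acset
     (alpha_class (name_sort T) (act_pair (perm_act T) (perm_formula T)) (bn T \<alpha>) (\<alpha>, A)))"

inductive is_formula ::
  "('n, 't, 's, 'p, 'a) nts \<Rightarrow> ('s, 'a) effect_map \<Rightarrow> 'k rel \<Rightarrow>
     's effect set \<Rightarrow> ('k, 'n, 's, 'p, 'a) formula \<Rightarrow> bool"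
  for T :: "('n, 't, 's, 'p, 'a) nts" and L :: "('s, 'a) effect_map" and \<kappa> :: "'k rel" where
  Conj: "\<lbrakk>\<forall>A \<in> S. is_formula T L \<kappa> F A; |S| <o \<kappa>;
          finitely_supported (name_sort T) (act_set (perm_formula T)) S\<rbrakk>
         \<Longrightarrow> is_formula T L \<kappa> F (Conj S)"
| Neg: "is_formula T L \<kappa> F A \<Longrightarrow> is_formula T L \<kappa> F (Neg A)"
| Eff_Pred: "f \<in> F \<Longrightarrow> is_formula T L \<kappa> F (Eff_Pred f \<phi>)"
| Mod: "\<lbrakk>f \<in> F; bn_fresh T \<alpha> F f; is_formula T L \<kappa> (L \<alpha> F f) A\<rbrakk>
        \<Longrightarrow> is_formula T L \<kappa> F (Mod T f \<alpha> A)"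

definition formulas ::
  "('n, 't, 's, 'p, 'a) nts \<Rightarrow> ('s, 'a) effect_map \<Rightarrow> 'k rel \<Rightarrow>
     's effect set \<Rightarrow> ('k, 'n, 's, 'p, 'a) formula set" where
  "formulas T L \<kappa> F = {A. is_formula T L \<kappa> F A}"

text \<open>
  Satisfaction carries the index \<open>F\<close> of the set of formulas under consideration, because
  representatives of a modality are to be fresh for \<open>F\<close> too. Its equations in terms of \<open>Conj\<close> and
  \<open>Mod\<close> are \<open>satisfies_Conj\<close> and \<open>satisfies_Mod\<close>.
\<close>

primrec satisfies ::
  "('n, 't, 's, 'p, 'a) nts \<Rightarrow> ('s, 'a) effect_map \<Rightarrow>
     ('k, 'n, 's, 'p, 'a) formula \<Rightarrow> 's effect set \<Rightarrow> 's \<Rightarrow> bool" where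
  "satisfies T L (Conj_raw m) = (\<lambda>F P. \<forall>X \<in> ran (map_option (satisfies T L) \<circ> m). X F P)"
| "satisfies T L (Neg A) = (\<lambda>F P. \<not> satisfies T L A F P)"
| "satisfies T L (Eff_Pred f \<phi>) = (\<lambda>F P. (f P, \<phi>) \<in> models T)"
| "satisfies T L (Mod_raw f C) = (\<lambda>F P.
     \<exists>(N, \<alpha>, X) \<in> rcset (cimage (map_prod id (map_prod id (satisfies T L))) C).
       fresh (name_sort T) (perm_state T) (bn T \<alpha>) (f P) \<and> bn_fresh T \<alpha> F f \<and>
       (\<exists>P'. step T (f P) \<alpha> P' \<and> X (L \<alpha> F f) P'))"


section \<open>Adequacy of the representation\<close>

lemma ran_Some_ran:
  fixes S :: "'x set"
  assumes "|S| \<le>o |UNIV :: 'k set|"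
  shows "ran (SOME m :: 'k \<Rightarrow> 'x option. ran m = S) = S"
proof -
  obtain g :: "'x \<Rightarrow> 'k" where g: "inj_on g S"
    using assms by (auto simp flip: card_of_ordLeq)
  have "ran (\<lambda>k. if k \<in> g ` S then Some (inv_into S g k) else None) = inv_into S g ` g ` S"
    by (auto simp: ran_def)
  also have "\<dots> = S"
    using g by (simp add: image_image)
  finally have "ran (\<lambda>k. if k \<in> g ` S then Some (inv_into S g k) else None) = S" .
  then have "\<exists>m :: 'k \<Rightarrow> 'x option. ran m = S" by blast
  then show ?thesis by (rule someI_ex)
qed

lemma ordLess_Card_order_UNIV:
  fixes \<kappa> :: "'k rel"
  assumes "Card_order \<kappa>" "|S| <o \<kappa>"
  shows "|S| \<le>o |UNIV :: 'k set|"
proof -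
  have "|S| <o |Field \<kappa>|"
    using assms(2) ordIso_symmetric[OF card_of_Field_ordIso[OF assms(1)]]
    by (rule ordLess_ordIso_trans)
  from ordLess_imp_ordLeq[OF this] card_of_mono1[OF subset_UNIV]
  show ?thesis by (rule ordLeq_transitive)
qed

lemma Conj_inject:
  fixes S S' :: "('k, 'n, 's, 'p, 'a) formula set"
  assumes "|S| \<le>o |UNIV :: 'k set|" "|S'| \<le>o |UNIV :: 'k set|"
  shows "Conj S = Conj S' \<longleftrightarrow> S = S'"
  unfolding Conj_def formula.inject
  using ran_Some_ran[OF assms(1)] ran_Some_ran[OF assms(2)] by metis

lemma ran_map_option_comp: "ran (map_option h \<circ> m) = h ` ran m"
  by (auto simp: ran_def)

lemma perm_formula_Conj:
  fixes S :: "('k, 'n, 's, 'p, 'a) formula set"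
  assumes "|S| \<le>o |UNIV :: 'k set|"
  shows "perm_formula T \<pi> (Conj S) = Conj (perm_formula T \<pi> ` S)"
  using ran_Some_ran[OF assms] by (simp add: Conj_def ran_map_option_comp)

lemma satisfies_Conj:
  fixes S :: "('k, 'n, 's, 'p, 'a) formula set"
  assumes "|S| \<le>o |UNIV :: 'k set|"
  shows "satisfies T L (Conj S) F P \<longleftrightarrow> (\<forall>A \<in> S. satisfies T L A F P)"
  using ran_Some_ran[OF assms] by (simp add: Conj_def ran_map_option_comp)

lemma countable_perm:
  assumes "countable (UNIV :: 'n set)"
  shows "countable (UNIV :: 'n perm set)"
proof -
  let ?graph = "\<lambda>\<pi> :: 'n perm. (\<lambda>a. (a, \<pi> \<langle>$\<rangle> a)) ` affected \<pi>"
  have "inj ?graph"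
  proof (rule injI, rule perm_eqI)
    fix \<pi> \<sigma> :: "'n perm" and a
    assume "?graph \<pi> = ?graph \<sigma>"
    then have "(a, b) \<in> ?graph \<pi> \<longleftrightarrow> (a, b) \<in> ?graph \<sigma>" for b
      by simp
    then have "a \<in> affected \<pi> \<and> b = \<pi> \<langle>$\<rangle> a \<longleftrightarrow> a \<in> affected \<sigma> \<and> b = \<sigma> \<langle>$\<rangle> a" for b
      by (simp add: image_iff conj_commute)
    then show "\<pi> \<langle>$\<rangle> a = \<sigma> \<langle>$\<rangle> a"
      by (metis in_affected)
  qed
  moreover have "countable {G :: ('n \<times> 'n) set. finite G}"
  proof -
    have "countable (UNIV :: ('n \<times> 'n) set)"
      using assms countable_SIGMA[of UNIV "\<lambda>_. UNIV"] by simp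
    from countable_Collect_finite_subset[OF this] show ?thesis by simp
  qed
  then have "countable (range ?graph)"
    by (rule countable_subset[rotated]) auto
  ultimately show ?thesis
    by (rule countable_image_inj_on[rotated])
qed

lemma countable_alpha_class:
  assumes "name_supply srt"
  shows "countable (alpha_class srt p N x)"
proof -
  have "alpha_class srt p N x \<subseteq> range (\<lambda>\<pi>. act_pair act_names p \<pi> (N, x))"
    unfolding alpha_class_def alpha_eq_def by blast
  moreover have "countable (range (\<lambda>\<pi>. act_pair act_names p \<pi> (N, x)))"
    using assms countable_perm unfolding name_supply_def by (intro countable_image) blast
  ultimately show ?thesis by (rule countable_subset)
qed

lemma Mod_inject:
  assumes "name_supply (name_sort T)"
  shows "Mod T f \<alpha> A = Mod T g \<beta> B \<longleftrightarrow> f = g \<and>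
    alpha_class (name_sort T) (act_pair (perm_act T) (perm_formula T)) (bn T \<alpha>) (\<alpha>, A) =
    alpha_class (name_sort T) (act_pair (perm_act T) (perm_formula T)) (bn T \<beta>) (\<beta>, B)"
  unfolding Mod_def formula.inject
  by (subst acset_inject) (simp_all add: countable_alpha_class[OF assms])

lemma satisfies_Mod:
  assumes "name_supply (name_sort T)"
  shows "satisfies T L (Mod T f \<alpha> A) F P \<longleftrightarrow>
    (\<exists>N \<beta> B. (N, \<beta>, B) \<in> alpha_class (name_sort T) (act_pair (perm_act T) (perm_formula T))
                (bn T \<alpha>) (\<alpha>, A) \<and>
       fresh (name_sort T) (perm_state T) (bn T \<beta>) (f P) \<and> bn_fresh T \<beta> F f \<and>
       (\<exists>P'. step T (f P) \<beta> P' \<and> satisfies T L B (L \<beta> F f) P'))"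
proof -
  let ?C = "alpha_class (name_sort T) (act_pair (perm_act T) (perm_formula T)) (bn T \<alpha>) (\<alpha>, A)"
  have "rcset (acset ?C) = ?C"
    by (rule acset_inverse) (simp add: countable_alpha_class[OF assms])
  then show ?thesis
    unfolding Mod_def satisfies.simps cimage.rep_eq
    by (simp add: Bex_def image_iff split_def) metis
qed

end

theory Submission
  imports Defs
begin

text \<open>
  Bisimilar states satisfy the same formulas by induction on formulas; in the case of a modality
  the bound names are renamed so as to be fresh for both states, which is why the induction
  hypothesis is needed for all permuted copies of the formula. Conversely, logical equivalence is an
  \<open>L\<close>-bisimulation: if no \<open>\<alpha>\<close>-derivative \<open>Q'\<close> of \<open>f(Q)\<close> were equivalent to \<open>P'\<close>, the conjunction
  over all \<open>Q'\<close> of formulas that hold of \<open>P'\<close> but not of \<open>Q'\<close>, put under \<open>\<langle>f\<rangle>\<langle>\<alpha>\<rangle>\<close>, would separate \<open>P\<close>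
  from \<open>Q\<close>. The conjunction is finitely supported because each conjunct can be chosen with
  support contained in that of \<open>P'\<close> and \<open>L(\<alpha>, F, f)\<close>.
\<close>

section \<open>Sort-respecting permutations\<close>

unbundle permutation_syntax

text \<open>Freshness is asymmetric: the transition clause of an \<open>L\<close>-bisimulation asks
  the bound names to be fresh for f(Q), F and f, while satisfaction by P looks for a representative
  fresh for f(P), F and f. Every modality therefore goes through a renaming of bound names. That
  renaming must fix F and f, so that equivariance of \<open>L\<close> moves the index L(\<alpha>, F,
  f) along with the formula under the modality. It can be chosen so because the bound names are
  fresh for F and f. The two bounds on \<kappa> serve different purposes: \<kappa> > |STATES| allows
  one conjunct per derivative of f(Q), and \<kappa> > aleph_0 allows the conjunction over an orbit
  of a formula under permutations, of which there are only countably many. Raw formulas do not form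
  a nominal set, so arguments about supports of formulas take place in the subset
  \<open>nominal_formulas\<close>, which contains every admissible formula.\<close>

lemma perm_left_inverse: "inverse \<pi> * \<pi> = (1 :: 'n perm)"
  by (rule perm_eqI) (simp add: apply_times apply_inverse bij_is_inj)

lemma perm_right_inverse: "\<pi> * inverse \<pi> = (1 :: 'n perm)"
  by (rule perm_eqI) (simp add: apply_times apply_inverse bij_is_surj surj_f_inv_f)

lemma apply_inverse_cancel [simp]:
  "inverse \<pi> \<langle>$\<rangle> (\<pi> \<langle>$\<rangle> a) = a" "\<pi> \<langle>$\<rangle> (inverse \<pi> \<langle>$\<rangle> a) = a"
  by (simp_all add: apply_sequence perm_left_inverse perm_right_inverse)

lemma apply_inverse_fixed: "\<pi> \<langle>$\<rangle> a = a \<Longrightarrow> inverse \<pi> \<langle>$\<rangle> a = a"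
  by (metis apply_inverse_cancel(1))

lemma one_in_perms: "1 \<in> perms srt"
  by (simp add: perms_def)

lemma times_in_perms: "\<pi> \<in> perms srt \<Longrightarrow> \<sigma> \<in> perms srt \<Longrightarrow> \<pi> * \<sigma> \<in> perms srt"
  by (simp add: perms_def apply_times)

lemma inverse_in_perms:
  assumes "\<pi> \<in> perms srt"
  shows "inverse \<pi> \<in> perms srt"
  unfolding perms_def
proof (standard, standard)
  fix a
  have "srt (\<pi> \<langle>$\<rangle> (inverse \<pi> \<langle>$\<rangle> a)) = srt (inverse \<pi> \<langle>$\<rangle> a)"
    using assms unfolding perms_def by blast
  then show "srt (inverse \<pi> \<langle>$\<rangle> a) = srt a" by simp
qed

lemma swap_in_perms:
  assumes "srt a = srt b"
  shows "\<langle>a \<leftrightarrow> b\<rangle> \<in> perms srt"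
  unfolding perms_def
proof (standard, standard)
  show "srt (\<langle>a \<leftrightarrow> b\<rangle> \<langle>$\<rangle> c) = srt c" for c
    using assms by (cases "c = a"; cases "c = b") simp_all
qed

lemma ex_perm_fresh:
  assumes srt: "name_supply srt" and "finite B" "finite Y"
  shows "\<exists>\<pi> \<in> perms srt. (\<forall>a \<in> B. \<pi> \<langle>$\<rangle> a \<notin> Y) \<and> (\<forall>a \<in> Y - B. \<pi> \<langle>$\<rangle> a = a)"
  using assms(2,3)
proof (induction B arbitrary: Y rule: finite_induct)
  case empty
  show ?case by (rule bexI[of _ 1]) (simp_all add: one_in_perms)
next
  case (insert b B)
  obtain \<pi> where \<pi>: "\<pi> \<in> perms srt" "\<forall>a \<in> B. \<pi> \<langle>$\<rangle> a \<notin> insert b Y"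
    "\<forall>a \<in> insert b Y - B. \<pi> \<langle>$\<rangle> a = a"
    using insert.IH[of "insert b Y"] insert.prems by auto
  have "infinite ({c. srt c = srt b} - (Y \<union> apply \<pi> ` B))"
    using srt insert.prems insert.hyps(1) unfolding name_supply_def by (simp add: Diff_infinite_finite)
  from infinite_imp_nonempty[OF this]
  obtain c where c: "srt c = srt b" "c \<notin> Y" "c \<notin> apply \<pi> ` B"
    by blast
  show ?case
  proof (rule bexI[of _ "\<langle>b \<leftrightarrow> c\<rangle> * \<pi>"], intro conjI ballI)
    show "\<langle>b \<leftrightarrow> c\<rangle> * \<pi> \<in> perms srt"
      using \<pi>(1) c(1) by (simp add: times_in_perms swap_in_perms)
    show "(\<langle>b \<leftrightarrow> c\<rangle> * \<pi>) \<langle>$\<rangle> a \<notin> Y" if "a \<in> insert b B" for a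
    proof (cases "a = b")
      case True
      then show ?thesis using \<pi>(3) insert.hyps(2) c by (simp add: apply_times)
    next
      case False
      with that have "a \<in> B" by simp
      moreover from this have "\<pi> \<langle>$\<rangle> a \<noteq> b" "\<pi> \<langle>$\<rangle> a \<noteq> c" using \<pi>(2) c(3) by auto
      ultimately show ?thesis using \<pi>(2) by (simp add: apply_times)
    qed
    show "(\<langle>b \<leftrightarrow> c\<rangle> * \<pi>) \<langle>$\<rangle> a = a" if "a \<in> Y - insert b B" for a
    proof -
      have "\<pi> \<langle>$\<rangle> a = a" "a \<noteq> b" "a \<noteq> c" using that \<pi>(3) c(2) by auto
      then show ?thesis by (simp add: apply_times)
    qed
  qed
qed

text \<open>Each induction step corrects the value at \<open>b\<close> by swapping
  \<open>\<tau> b\<close> with \<open>\<sigma> b\<close>. Both have the sort of \<open>b\<close>,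
  and by injectivity neither is a value already settled on \<open>B\<close>. The lemma cuts a
  renaming between two representatives down to the bound names and their images.\<close>

lemma ex_perm_restrict:
  assumes \<sigma>: "\<sigma> \<in> perms srt" and "finite B"
  shows "\<exists>\<tau> \<in> perms srt. (\<forall>a \<in> B. \<tau> \<langle>$\<rangle> a = \<sigma> \<langle>$\<rangle> a) \<and>
    (\<forall>a. a \<notin> B \<union> apply \<sigma> ` B \<longrightarrow> \<tau> \<langle>$\<rangle> a = a)"
  using assms(2)
proof (induction B rule: finite_induct)
  case empty
  show ?case by (rule bexI[of _ 1]) (simp_all add: one_in_perms)
next
  case (insert b B)
  then obtain \<tau> where \<tau>: "\<tau> \<in> perms srt" "\<forall>a \<in> B. \<tau> \<langle>$\<rangle> a = \<sigma> \<langle>$\<rangle> a"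
    "\<forall>a. a \<notin> B \<union> apply \<sigma> ` B \<longrightarrow> \<tau> \<langle>$\<rangle> a = a"
    by blast
  let ?s = "\<langle>\<tau> \<langle>$\<rangle> b \<leftrightarrow> \<sigma> \<langle>$\<rangle> b\<rangle>"
  show ?case
  proof (rule bexI[of _ "?s * \<tau>"], intro conjI ballI allI impI)
    show "?s * \<tau> \<in> perms srt"
      using \<tau>(1) \<sigma> by (intro times_in_perms swap_in_perms) (simp_all add: perms_def)
    show "(?s * \<tau>) \<langle>$\<rangle> a = \<sigma> \<langle>$\<rangle> a" if "a \<in> insert b B" for a
    proof (cases "a = b")
      case False
      then have "\<tau> \<langle>$\<rangle> a \<noteq> \<tau> \<langle>$\<rangle> b" "\<tau> \<langle>$\<rangle> a = \<sigma> \<langle>$\<rangle> a" "\<sigma> \<langle>$\<rangle> a \<noteq> \<sigma> \<langle>$\<rangle> b"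
        using that \<tau>(2) by (auto simp: apply_inj)
      then show ?thesis by (simp add: apply_times)
    qed (simp add: apply_times)
    show "(?s * \<tau>) \<langle>$\<rangle> a = a" if "a \<notin> insert b B \<union> apply \<sigma> ` insert b B" for a
    proof -
      have "\<tau> \<langle>$\<rangle> a = a" "a \<noteq> \<sigma> \<langle>$\<rangle> b" "a \<noteq> b" using that \<tau>(3) by auto
      moreover from this have "a \<noteq> \<tau> \<langle>$\<rangle> b" by (metis apply_inj)
      ultimately show ?thesis by (simp add: apply_times)
    qed
  qed
qed


section \<open>Supports and abstraction classes\<close>

lemma act_names_image: "act_names \<pi> N = apply \<pi> ` N"
  by (simp add: act_names_def act_set_def)

lemma supp_subset: "finite N \<Longrightarrow> supports srt p N x \<Longrightarrow> supp srt p x \<subseteq> N"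
  unfolding supp_def by blast

lemma finitely_supportedI: "finite N \<Longrightarrow> supports srt p N x \<Longrightarrow> finitely_supported srt p x"
  unfolding finitely_supported_def by blast

lemma nominal_set_finitely_supported:
  "nominal_set srt p X \<Longrightarrow> x \<in> X \<Longrightarrow> finitely_supported srt p x"
  by (simp add: nominal_set_def)

text \<open>If \<open>\<sigma>\<close> fixes the image of \<open>N\<close>, its conjugate by
  \<open>\<pi>\<close> fixes \<open>N\<close>. The law for products is assumed at \<open>x\<close>
  alone, so that the lemma also covers raw formulas and sets before they are known to belong to a
  nominal set.\<close>

lemma supports_act_if_times:
  assumes times: "\<And>\<pi> \<sigma>. \<pi> \<in> perms srt \<Longrightarrow> \<sigma> \<in> perms srt \<Longrightarrow> p (\<pi> * \<sigma>) x = p \<pi> (p \<sigma> x)"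
    and \<pi>: "\<pi> \<in> perms srt" and N: "supports srt p N x"
  shows "supports srt p (apply \<pi> ` N) (p \<pi> x)"
  unfolding supports_def
proof (intro ballI impI)
  fix \<sigma> assume \<sigma>: "\<sigma> \<in> perms srt" "\<forall>a \<in> apply \<pi> ` N. \<sigma> \<langle>$\<rangle> a = a"
  have c: "inverse \<pi> * (\<sigma> * \<pi>) \<in> perms srt"
    using \<pi> \<sigma>(1) by (simp add: times_in_perms inverse_in_perms)
  moreover have "\<forall>a \<in> N. (inverse \<pi> * (\<sigma> * \<pi>)) \<langle>$\<rangle> a = a"
    using \<sigma>(2) by (simp add: apply_times)
  ultimately have "p (inverse \<pi> * (\<sigma> * \<pi>)) x = x"
    using N unfolding supports_def by blast
  then have "p \<pi> x = p (\<pi> * (inverse \<pi> * (\<sigma> * \<pi>))) x"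
    using \<pi> c by (simp add: times)
  also have "\<dots> = p \<sigma> (p \<pi> x)"
    using \<pi> \<sigma>(1) by (simp add: times perm_right_inverse flip: mult.assoc)
  finally show "p \<sigma> (p \<pi> x) = p \<pi> x" by simp
qed

locale nominal =
  fixes srt :: "'n \<Rightarrow> 't" and p :: "('n, 'x) action" and X :: "'x set"
  assumes srt: "name_supply srt" and nominal: "nominal_set srt p X"
begin

lemma act_one [simp]: "x \<in> X \<Longrightarrow> p 1 x = x"
  using nominal unfolding nominal_set_def by blast

lemma act_closed: "\<pi> \<in> perms srt \<Longrightarrow> x \<in> X \<Longrightarrow> p \<pi> x \<in> X"
  using nominal unfolding nominal_set_def by blast

lemma act_times: "\<pi> \<in> perms srt \<Longrightarrow> \<sigma> \<in> perms srt \<Longrightarrow> x \<in> X \<Longrightarrow> p (\<pi> * \<sigma>) x = p \<pi> (p \<sigma> x)"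
  using nominal unfolding nominal_set_def by blast

lemma act_inverse:
  assumes "\<pi> \<in> perms srt" "x \<in> X"
  shows "p (inverse \<pi>) (p \<pi> x) = x" "p \<pi> (p (inverse \<pi>) x) = x"
  using assms by (simp_all add: inverse_in_perms perm_left_inverse perm_right_inverse flip: act_times)

lemma supports_act:
  "\<pi> \<in> perms srt \<Longrightarrow> x \<in> X \<Longrightarrow> supports srt p N x \<Longrightarrow> supports srt p (apply \<pi> ` N) (p \<pi> x)"
  by (rule supports_act_if_times) (simp_all add: act_times)

text \<open>Move the names of \<open>N - M\<close>, fixing \<open>M\<close>, away from those affected by a given permutation.\<close>

lemma supports_Int:
  assumes x: "x \<in> X" and M: "finite M" "supports srt p M x" and N: "finite N" "supports srt p N x"
  shows "supports srt p (M \<inter> N) x"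
  unfolding supports_def
proof (intro ballI impI)
  fix \<pi> assume \<pi>: "\<pi> \<in> perms srt" "\<forall>a \<in> M \<inter> N. \<pi> \<langle>$\<rangle> a = a"
  obtain \<rho> where \<rho>: "\<rho> \<in> perms srt" "\<forall>a \<in> N - M. \<rho> \<langle>$\<rangle> a \<notin> M \<union> affected \<pi>"
    "\<forall>a \<in> M \<union> affected \<pi> - (N - M). \<rho> \<langle>$\<rangle> a = a"
    using ex_perm_fresh[OF srt, of "N - M" "M \<union> affected \<pi>"] M(1) N(1) by auto
  have "p \<rho> x = x" using M(2) \<rho>(1,3) unfolding supports_def by blast
  then have "supports srt p (apply \<rho> ` N) x"
    using supports_act[OF \<rho>(1) x N(2)] by simp
  \<comment> \<open>A name of \<open>N\<close> either lies in \<open>M\<close>, where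
    \<open>\<rho>\<close> is the identity and \<open>\<pi>\<close> fixes it by assumption, or is
    sent by \<open>\<rho>\<close> outside the names that \<open>\<pi>\<close> moves.\<close>
  moreover have "\<forall>a \<in> apply \<rho> ` N. \<pi> \<langle>$\<rangle> a = a"
  proof
    fix b assume "b \<in> apply \<rho> ` N"
    then obtain a where a: "a \<in> N" "b = \<rho> \<langle>$\<rangle> a" by blast
    show "\<pi> \<langle>$\<rangle> b = b"
      using a \<pi>(2) \<rho>(2,3) by (cases "a \<in> M") (auto simp: in_affected)
  qed
  ultimately show "p \<pi> x = x" using \<pi>(1) unfolding supports_def by blast
qed

text \<open>A finite support of least cardinality is contained in every other finite support, since
  by \<open>supports_Int\<close> the intersection of the two is again a support. Hence the
  intersection that defines \<open>supp\<close> is attained.\<close>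

lemma supp_supports:
  assumes x: "x \<in> X"
  shows "finite (supp srt p x)" "supports srt p (supp srt p x) x"
proof -
  obtain N\<^sub>0 where "finite N\<^sub>0 \<and> supports srt p N\<^sub>0 x"
    using nominal_set_finitely_supported[OF nominal x] unfolding finitely_supported_def by blast
  from ex_has_least_nat[of "\<lambda>N. finite N \<and> supports srt p N x", OF this, of card]
  obtain N where N: "finite N" "supports srt p N x"
    and min: "\<And>M. finite M \<Longrightarrow> supports srt p M x \<Longrightarrow> card N \<le> card M"
    by blast
  have "N \<subseteq> M" if "finite M" "supports srt p M x" for M
  proof -
    have "card N \<le> card (M \<inter> N)" using min supports_Int[OF x that N] N(1) by simp
    then have "M \<inter> N = N" using N(1) by (intro card_seteq) auto
    then show ?thesis by blast
  qed
  then have "supp srt p x = N" using N unfolding supp_def by blast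
  then show "finite (supp srt p x)" "supports srt p (supp srt p x) x" using N by simp_all
qed

lemma act_fixed:
  "\<pi> \<in> perms srt \<Longrightarrow> x \<in> X \<Longrightarrow> \<forall>a \<in> supp srt p x. \<pi> \<langle>$\<rangle> a = a \<Longrightarrow> p \<pi> x = x"
  using supp_supports(2) unfolding supports_def by blast

lemma act_cong:
  assumes "\<pi> \<in> perms srt" "\<sigma> \<in> perms srt" "x \<in> X" "\<forall>a \<in> supp srt p x. \<pi> \<langle>$\<rangle> a = \<sigma> \<langle>$\<rangle> a"
  shows "p \<pi> x = p \<sigma> x"
proof -
  have "p (inverse \<sigma> * \<pi>) x = x"
    using assms by (intro act_fixed) (simp_all add: times_in_perms inverse_in_perms apply_times)
  then have "p \<sigma> x = p (\<sigma> * (inverse \<sigma> * \<pi>)) x"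
    using assms by (simp add: act_times times_in_perms inverse_in_perms)
  then show ?thesis by (simp add: perm_right_inverse flip: mult.assoc)
qed

lemma supp_act:
  assumes \<pi>: "\<pi> \<in> perms srt" and x: "x \<in> X"
  shows "supp srt p (p \<pi> x) = apply \<pi> ` supp srt p x"
proof
  show sub: "supp srt p (p \<pi> x) \<subseteq> apply \<pi> ` supp srt p x"
    using supp_supports[OF x] supports_act[OF \<pi> x] by (intro supp_subset) auto
  let ?y = "p \<pi> x"
  have y: "?y \<in> X" using \<pi> x by (rule act_closed)
  have "supp srt p (p (inverse \<pi>) ?y) \<subseteq> apply (inverse \<pi>) ` supp srt p ?y"
    using supp_supports[OF y] supports_act[OF inverse_in_perms[OF \<pi>] y] by (intro supp_subset) auto
  then have "supp srt p x \<subseteq> apply (inverse \<pi>) ` supp srt p ?y"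
    using \<pi> x by (simp add: act_inverse)
  from image_mono[OF this, of "apply \<pi>"] show "apply \<pi> ` supp srt p x \<subseteq> supp srt p ?y"
    by (simp add: image_image)
qed

lemma fresh_act:
  assumes "\<pi> \<in> perms srt" "x \<in> X"
  shows "fresh srt p (apply \<pi> ` N) (p \<pi> x) \<longleftrightarrow> fresh srt p N x"
  using supp_act[OF assms] unfolding fresh_def by (auto simp: apply_inj)

lemma alpha_eq_act:
  assumes \<pi>: "\<pi> \<in> perms srt" and x: "x \<in> X" and eq: "alpha_eq srt p (N, x) (M, y)"
  shows "alpha_eq srt p (apply \<pi> ` N, p \<pi> x) (apply \<pi> ` M, p \<pi> y)"
proof -
  obtain \<sigma> where \<sigma>: "\<sigma> \<in> perms srt" "M = apply \<sigma> ` N" "y = p \<sigma> x"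
    "\<forall>a \<in> supp srt p x - N. \<sigma> \<langle>$\<rangle> a = a"
    using eq unfolding alpha_eq_def act_pair_def by (auto simp: act_names_image)
  \<comment> \<open>Conjugation turns a renaming between the old representatives into one between
    their images.\<close>
  let ?\<tau> = "\<pi> * \<sigma> * inverse \<pi>"
  have "?\<tau> \<in> perms srt"
    using \<pi> \<sigma>(1) by (simp add: times_in_perms inverse_in_perms)
  moreover have "apply ?\<tau> ` apply \<pi> ` N = apply \<pi> ` M"
    unfolding \<sigma>(2) by (simp add: apply_times image_image)
  moreover have "p ?\<tau> (p \<pi> x) = p \<pi> y"
    unfolding \<sigma>(3) using \<pi> \<sigma>(1) x
    by (simp add: act_times act_closed act_inverse times_in_perms inverse_in_perms)
  moreover have "\<forall>a \<in> supp srt p (p \<pi> x) - apply \<pi> ` N. ?\<tau> \<langle>$\<rangle> a = a"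
    using \<sigma>(4) unfolding supp_act[OF \<pi> x] by (auto simp: apply_times apply_inj image_iff Ball_def)
  ultimately show ?thesis
    unfolding alpha_eq_def act_pair_def by (auto simp: act_names_image)
qed

lemma alpha_class_act:
  assumes \<pi>: "\<pi> \<in> perms srt" and x: "x \<in> X"
  shows "act_pair act_names p \<pi> ` alpha_class srt p N x = alpha_class srt p (apply \<pi> ` N) (p \<pi> x)"
proof (intro equalityI subsetI)
  show "z \<in> alpha_class srt p (apply \<pi> ` N) (p \<pi> x)"
    if "z \<in> act_pair act_names p \<pi> ` alpha_class srt p N x" for z
    using that alpha_eq_act[OF \<pi> x]
    unfolding alpha_class_def act_pair_def by (auto simp: act_names_image)
next
  fix z assume "z \<in> alpha_class srt p (apply \<pi> ` N) (p \<pi> x)"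
  then obtain M y where z: "z = (M, y)" and eq: "alpha_eq srt p (apply \<pi> ` N, p \<pi> x) (M, y)"
    unfolding alpha_class_def by (cases z) auto
  have "y \<in> X"
    using eq act_closed \<pi> x unfolding alpha_eq_def act_pair_def by auto
  have "alpha_eq srt p (N, x) (apply (inverse \<pi>) ` M, p (inverse \<pi>) y)"
    using alpha_eq_act[OF inverse_in_perms[OF \<pi>] act_closed[OF \<pi> x] eq] \<pi> x
    by (simp add: act_inverse image_image)
  moreover have "z = act_pair act_names p \<pi> (apply (inverse \<pi>) ` M, p (inverse \<pi>) y)"
    using \<pi> \<open>y \<in> X\<close> z by (simp add: act_pair_def act_names_image image_image act_inverse)
  ultimately show "z \<in> act_pair act_names p \<pi> ` alpha_class srt p N x"
    unfolding alpha_class_def by blast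
qed

lemma alpha_eq_refl: "x \<in> X \<Longrightarrow> alpha_eq srt p (N, x) (N, x)"
  unfolding alpha_eq_def act_pair_def
  by (rule bexI[of _ 1]) (simp_all add: act_names_image one_in_perms)

text \<open>Free names of \<open>x\<close> are fixed by \<open>\<pi>\<close>, hence still free in
  the renamed element, hence fixed by any further renaming \<open>\<sigma>\<close>; so
  \<open>\<sigma> * \<pi>\<close> is a renaming of the original. The reverse inclusion is the same
  fact for \<open>inverse \<pi>\<close>, which gives equality of classes.\<close>

lemma alpha_class_rename_subset:
  assumes \<pi>: "\<pi> \<in> perms srt" and x: "x \<in> X" and fixed: "\<forall>a \<in> supp srt p x - N. \<pi> \<langle>$\<rangle> a = a"
  shows "alpha_class srt p (apply \<pi> ` N) (p \<pi> x) \<subseteq> alpha_class srt p N x"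
proof
  fix z assume "z \<in> alpha_class srt p (apply \<pi> ` N) (p \<pi> x)"
  then obtain \<sigma> where \<sigma>: "\<sigma> \<in> perms srt" "z = (apply \<sigma> ` apply \<pi> ` N, p \<sigma> (p \<pi> x))"
    "\<forall>a \<in> supp srt p (p \<pi> x) - apply \<pi> ` N. \<sigma> \<langle>$\<rangle> a = a"
    unfolding alpha_class_def alpha_eq_def act_pair_def by (auto simp: act_names_image)
  have "(\<sigma> * \<pi>) \<langle>$\<rangle> a = a" if "a \<in> supp srt p x - N" for a
  proof -
    have "\<pi> \<langle>$\<rangle> a \<in> supp srt p (p \<pi> x) - apply \<pi> ` N"
      using that by (auto simp: supp_act[OF \<pi> x] apply_inj)
    then show ?thesis using \<sigma>(3) fixed that by (simp add: apply_times)
  qed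
  moreover have "z = act_pair act_names p (\<sigma> * \<pi>) (N, x)"
    using \<sigma> \<pi> x by (simp add: act_pair_def act_names_image act_times apply_times image_comp)
  ultimately show "z \<in> alpha_class srt p N x"
    using times_in_perms[OF \<sigma>(1) \<pi>] unfolding alpha_class_def alpha_eq_def by auto
qed

lemma alpha_class_rename:
  assumes \<pi>: "\<pi> \<in> perms srt" and x: "x \<in> X" and fixed: "\<forall>a \<in> supp srt p x - N. \<pi> \<langle>$\<rangle> a = a"
  shows "alpha_class srt p (apply \<pi> ` N) (p \<pi> x) = alpha_class srt p N x"
proof
  have "\<forall>a \<in> supp srt p (p \<pi> x) - apply \<pi> ` N. inverse \<pi> \<langle>$\<rangle> a = a"
  proof
    fix b assume b: "b \<in> supp srt p (p \<pi> x) - apply \<pi> ` N"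
    then obtain a where a: "a \<in> supp srt p x" "b = \<pi> \<langle>$\<rangle> a"
      unfolding supp_act[OF \<pi> x] by blast
    then have "\<pi> \<langle>$\<rangle> a = a" using b fixed by blast
    then show "inverse \<pi> \<langle>$\<rangle> b = b" unfolding a(2) by (simp add: apply_inverse_fixed)
  qed
  from alpha_class_rename_subset[OF inverse_in_perms[OF \<pi>] act_closed[OF \<pi> x] this]
  show "alpha_class srt p N x \<subseteq> alpha_class srt p (apply \<pi> ` N) (p \<pi> x)"
    using \<pi> x by (simp add: act_inverse image_image)
qed (rule alpha_class_rename_subset[OF assms])

text \<open>The renaming between two representatives need only move bound names, so it can be chosen to
  fix any set of names that avoids the bound names of both.\<close>

lemma alpha_classE:
  assumes x: "x \<in> X" and N: "finite N" and mem: "(M, y) \<in> alpha_class srt p N x"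
    and Z: "N \<inter> Z = {}" "M \<inter> Z = {}"
  obtains \<tau> where "\<tau> \<in> perms srt" "M = apply \<tau> ` N" "y = p \<tau> x"
    "\<forall>a \<in> supp srt p x - N. \<tau> \<langle>$\<rangle> a = a" "\<forall>a \<in> Z. \<tau> \<langle>$\<rangle> a = a"
proof -
  obtain \<sigma> where \<sigma>: "\<sigma> \<in> perms srt" "M = apply \<sigma> ` N" "y = p \<sigma> x"
    "\<forall>a \<in> supp srt p x - N. \<sigma> \<langle>$\<rangle> a = a"
    using mem unfolding alpha_class_def alpha_eq_def act_pair_def by (auto simp: act_names_image)
  obtain \<tau> where \<tau>: "\<tau> \<in> perms srt" "\<forall>a \<in> N. \<tau> \<langle>$\<rangle> a = \<sigma> \<langle>$\<rangle> a"
    "\<forall>a. a \<notin> N \<union> apply \<sigma> ` N \<longrightarrow> \<tau> \<langle>$\<rangle> a = a"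
    using ex_perm_restrict[OF \<sigma>(1) N] by blast
  have fixed: "\<tau> \<langle>$\<rangle> a = a" if "a \<in> supp srt p x - N" for a
  proof -
    \<comment> \<open>A free name is fixed by \<open>\<sigma>\<close>, so by injectivity it is not
      the image of a bound name. It therefore lies outside the names that \<open>\<tau>\<close> may
      move.\<close>
    have "a \<notin> apply \<sigma> ` N" using that \<sigma>(4) by (metis DiffD2 apply_inj imageE)
    then show ?thesis using that \<tau>(3) by blast
  qed
  have "p \<tau> x = p \<sigma> x"
  proof (rule act_cong[OF \<tau>(1) \<sigma>(1) x], rule ballI)
    show "\<tau> \<langle>$\<rangle> a = \<sigma> \<langle>$\<rangle> a" if "a \<in> supp srt p x" for a
      using that fixed \<sigma>(4) \<tau>(2) by (cases "a \<in> N") auto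
  qed
  moreover have "M = apply \<tau> ` N"
    unfolding \<sigma>(2) using \<tau>(2) by (intro image_cong) auto
  moreover have "\<forall>a \<in> Z. \<tau> \<langle>$\<rangle> a = a"
    using \<tau>(3) Z unfolding \<sigma>(2) by blast
  ultimately show thesis
    using that[OF \<tau>(1)] \<sigma>(3) fixed by simp
qed

end

section \<open>Products and finitely supported subsets of nominal sets\<close>

lemma nominal_act_pair:
  assumes "nominal_set srt p X" "nominal_set srt q Y"
  shows "nominal_set srt (act_pair p q) (X \<times> Y)"
proof -
  have "finitely_supported srt (act_pair p q) (x, y)" if xy: "x \<in> X" "y \<in> Y" for x y
  proof -
    obtain M where "finite M" "supports srt p M x"
      using nominal_set_finitely_supported[OF assms(1) xy(1)] unfolding finitely_supported_def by blast
    moreover obtain N where "finite N" "supports srt q N y"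
      using nominal_set_finitely_supported[OF assms(2) xy(2)] unfolding finitely_supported_def by blast
    ultimately have "finite (M \<union> N)" "supports srt (act_pair p q) (M \<union> N) (x, y)"
      unfolding supports_def act_pair_def by auto
    then show ?thesis by (rule finitely_supportedI)
  qed
  then show ?thesis
    using assms unfolding nominal_set_def by (auto simp: act_pair_def)
qed

lemma nominal_act_set:
  assumes "name_supply srt" "nominal_set srt p X"
  shows "nominal_set srt (act_set p) {S. S \<subseteq> X \<and> finitely_supported srt (act_set p) S}"
proof -
  interpret nominal srt p X using assms by unfold_locales
  have times: "act_set p (\<pi> * \<sigma>) S = act_set p \<pi> (act_set p \<sigma> S)"
    if "\<pi> \<in> perms srt" "\<sigma> \<in> perms srt" "S \<subseteq> X" for \<pi> \<sigma> S
    using that unfolding act_set_def image_image by (intro image_cong) (auto simp: act_times)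
  have fs: "finitely_supported srt (act_set p) (act_set p \<pi> S)"
    if \<pi>: "\<pi> \<in> perms srt" and S: "S \<subseteq> X" "finitely_supported srt (act_set p) S" for \<pi> S
  proof -
    obtain N where N: "finite N" "supports srt (act_set p) N S"
      using S(2) unfolding finitely_supported_def by blast
    have "supports srt (act_set p) (apply \<pi> ` N) (act_set p \<pi> S)"
      using \<pi> S(1) N(2) by (intro supports_act_if_times) (simp_all add: times)
    then show ?thesis using N(1) by (intro finitely_supportedI) auto
  qed
  show ?thesis
    unfolding nominal_set_def
    using fs times by (auto simp: act_set_def act_closed subset_iff image_iff)
qed


section \<open>Formulas and satisfaction under permutations\<close>

text \<open>Needed for arbitrary \<open>Conj_raw\<close> nodes: the set stored in one, and every
  image of it, is small enough for \<open>Conj\<close> to store it faithfully.\<close>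

lemma card_ran_le_UNIV: "|ran (m :: 'i \<Rightarrow> 'x option)| \<le>o |UNIV :: 'i set|"
proof -
  have "ran m \<subseteq> (the \<circ> m) ` UNIV"
    by (auto simp: ran_def image_iff) (metis option.sel)
  then show ?thesis by (rule ordLeq_transitive[OF card_of_mono1 card_of_image])
qed

section \<open>Equivariance of effects, transitions and the map \<open>L\<close>\<close>

locale effect_nts =
  fixes T :: "('n, 't, 's, 'p, 'a) nts"
    and \<F> :: "'s effect set"
    and L :: "('s, 'a) effect_map"
    and \<kappa> :: "'k rel"
  assumes nts: "nominal_transition_system T"
    and effects: "effect_set T \<F>"
    and L: "equivariant_effect_map T \<F> L"
    and card_order: "Card_order \<kappa>"
    and uncountable: "natLeq <o \<kappa>"
    and states_less: "|UNIV :: 's set| <o \<kappa>"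
begin

abbreviation srt :: "'n \<Rightarrow> 't" where "srt \<equiv> name_sort T"
abbreviation perm_effects :: "('n, 's effect set) action" where
  "perm_effects \<equiv> act_set (act_effect T)"

lemma name_supply_T: "name_supply srt"
  using nts unfolding nominal_transition_system_def by blast

lemma equivariant_T:
  "equivariant srt (act_set (act_pair (perm_state T) (perm_pred T))) (models T)"
  "equivariant srt (act_fun (perm_act T) act_names) (bn T)"
  "equivariant srt
    (act_set (act_pair (perm_state T) (act_set (act_pair act_names (act_residual T)))))
    (transitions T)"
  using nts unfolding nominal_transition_system_def by - (elim conjE, assumption)+

interpretation S: nominal srt "perm_state T" UNIV
  using nts unfolding nominal_transition_system_def by unfold_locales blast+

interpretation P: nominal srt "perm_pred T" UNIV
  using nts unfolding nominal_transition_system_def by unfold_locales blast+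

interpretation A: nominal srt "perm_act T" UNIV
  using nts unfolding nominal_transition_system_def by unfold_locales blast+

interpretation E: nominal srt "act_effect T" \<F>
  using name_supply_T effects unfolding effect_set_def by unfold_locales

interpretation Es: nominal srt perm_effects "Pow_fs T \<F>"
  using name_supply_T nominal_act_set[OF name_supply_T E.nominal] unfolding Pow_fs_def by unfold_locales

interpretation AS: nominal srt "act_residual T" UNIV
  using name_supply_T nominal_act_pair[OF A.nominal S.nominal] unfolding act_residual_def
  by unfold_locales simp_all

lemma Pow_fsD: "F \<in> Pow_fs T \<F> \<Longrightarrow> f \<in> F \<Longrightarrow> f \<in> \<F>"
  unfolding Pow_fs_def by blast

lemma L_closed: "F \<in> Pow_fs T \<F> \<Longrightarrow> f \<in> F \<Longrightarrow> L \<alpha> F f \<in> Pow_fs T \<F>"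
  using L Pow_fsD unfolding equivariant_effect_map_def by blast

lemma L_act:
  "\<pi> \<in> perms srt \<Longrightarrow> F \<in> Pow_fs T \<F> \<Longrightarrow> f \<in> F \<Longrightarrow>
    L (perm_act T \<pi> \<alpha>) (perm_effects \<pi> F) (act_effect T \<pi> f) = perm_effects \<pi> (L \<alpha> F f)"
  using L Pow_fsD unfolding equivariant_effect_map_def by blast

lemma finite_bn: "finite (bn T \<alpha>)"
  using nts unfolding nominal_transition_system_def by blast

lemma bn_act:
  assumes "\<pi> \<in> perms srt"
  shows "bn T (perm_act T \<pi> \<alpha>) = apply \<pi> ` bn T \<alpha>"
proof -
  have "act_fun (perm_act T) act_names \<pi> (bn T) = bn T"
    using equivariant_T(2) assms unfolding equivariant_def by blast
  from fun_cong[OF this, of "perm_act T \<pi> \<alpha>"] show ?thesis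
    using assms by (simp add: act_fun_def act_names_image A.act_inverse)
qed

lemma act_effect_mem: "f \<in> F \<Longrightarrow> act_effect T \<pi> f \<in> perm_effects \<pi> F"
  by (simp add: act_set_def)

lemma act_effect_apply:
  "\<pi> \<in> perms srt \<Longrightarrow> act_effect T \<pi> f (perm_state T \<pi> P) = perm_state T \<pi> (f P)"
  by (simp add: act_effect_def act_fun_def S.act_inverse)

text \<open>Proved for all functions on states rather than for members of \<open>\<F>\<close>,
  because a raw formula may contain any function as its effect.\<close>

lemma act_effect_times:
  assumes "\<pi> \<in> perms srt" "\<sigma> \<in> perms srt"
  shows "act_effect T (\<pi> * \<sigma>) f = act_effect T \<pi> (act_effect T \<sigma> f)"
proof
  fix P
  have "inverse (\<pi> * \<sigma>) = inverse \<sigma> * inverse \<pi>"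
    by (rule perm_eqI) (metis apply_inverse_cancel apply_sequence)
  then show "act_effect T (\<pi> * \<sigma>) f P = act_effect T \<pi> (act_effect T \<sigma> f) P"
    using assms by (simp add: act_effect_def act_fun_def S.act_times inverse_in_perms)
qed

lemma models_act:
  assumes "\<pi> \<in> perms srt" "(P, \<phi>) \<in> models T"
  shows "(perm_state T \<pi> P, perm_pred T \<pi> \<phi>) \<in> models T"
proof -
  have "act_set (act_pair (perm_state T) (perm_pred T)) \<pi> (models T) = models T"
    using equivariant_T(1) assms(1) unfolding equivariant_def by blast
  moreover have "act_pair (perm_state T) (perm_pred T) \<pi> (P, \<phi>) \<in>
      act_set (act_pair (perm_state T) (perm_pred T)) \<pi> (models T)"
    unfolding act_set_def using assms(2) by (rule imageI)
  ultimately show ?thesis by (simp add: act_pair_def)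
qed

lemma step_act:
  assumes \<pi>: "\<pi> \<in> perms srt" and step: "step T P \<alpha> P'"
  shows "step T (perm_state T \<pi> P) (perm_act T \<pi> \<alpha>) (perm_state T \<pi> P')"
proof -
  let ?q = "act_set (act_pair act_names (act_residual T))"
  have "act_set (act_pair (perm_state T) ?q) \<pi> (transitions T) = transitions T"
    using equivariant_T(3) \<pi> unfolding equivariant_def by blast
  moreover have "act_pair (perm_state T) ?q \<pi> (P, residual T (bn T \<alpha>) (\<alpha>, P'))
      \<in> act_set (act_pair (perm_state T) ?q) \<pi> (transitions T)"
    using step unfolding step_def act_set_def[of "act_pair (perm_state T) _"] by (rule imageI)
  moreover have "?q \<pi> (residual T (bn T \<alpha>) (\<alpha>, P')) =
      residual T (bn T (perm_act T \<pi> \<alpha>)) (perm_act T \<pi> \<alpha>, perm_state T \<pi> P')"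
    unfolding residual_def act_set_def AS.alpha_class_act[OF \<pi> UNIV_I] bn_act[OF \<pi>]
    by (simp add: act_residual_def act_pair_def)
  ultimately show ?thesis
    unfolding step_def by (simp add: act_pair_def[of "perm_state T"])
qed

text \<open>A transition relates its source to a whole abstraction class. Renaming the bound names
  in label and derivative together leaves that class unchanged, so, unlike in
  \<open>step_act\<close>, the source stays put.\<close>

lemma step_rename:
  assumes \<pi>: "\<pi> \<in> perms srt" and step: "step T P \<alpha> P'"
    and fixed: "\<forall>a \<in> supp srt (act_residual T) (\<alpha>, P') - bn T \<alpha>. \<pi> \<langle>$\<rangle> a = a"
  shows "step T P (perm_act T \<pi> \<alpha>) (perm_state T \<pi> P')"
  using step AS.alpha_class_rename[OF \<pi> UNIV_I fixed]
  unfolding step_def residual_def bn_act[OF \<pi>] by (simp add: act_residual_def act_pair_def)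

lemma bn_fresh_act:
  assumes "\<pi> \<in> perms srt" "F \<in> Pow_fs T \<F>" "f \<in> F"
  shows "bn_fresh T (perm_act T \<pi> \<alpha>) (perm_effects \<pi> F) (act_effect T \<pi> f) \<longleftrightarrow> bn_fresh T \<alpha> F f"
  using assms Pow_fsD unfolding bn_fresh_def by (simp add: bn_act Es.fresh_act E.fresh_act)

section \<open>Permutations acting on formulas\<close>

text \<open>This holds for all raw formulas, although the identity law does not: on both sides a
  conjunction ends up in the form \<open>Conj\<close>, so only the sets of conjuncts have to
  agree.\<close>

lemma perm_formula_times:
  assumes \<pi>: "\<pi> \<in> perms srt" and \<sigma>: "\<sigma> \<in> perms srt"
  shows "perm_formula T (\<pi> * \<sigma>) A = perm_formula T \<pi> (perm_formula T \<sigma> A)"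
proof (induction A)
  case (Conj_raw m)
  have "perm_formula T (\<pi> * \<sigma>) A = perm_formula T \<pi> (perm_formula T \<sigma> A)" if "A \<in> ran m" for A
  proof -
    from that obtain i where "m i = Some A" by (auto simp: ran_def)
    then show ?thesis using Conj_raw[OF rangeI, of A i] by simp
  qed
  then have "perm_formula T (\<pi> * \<sigma>) ` ran m = perm_formula T \<pi> ` perm_formula T \<sigma> ` ran m"
    unfolding image_image by (intro image_cong) auto
  moreover have "|perm_formula T \<sigma> ` ran m| \<le>o |UNIV :: 'b set|"
    by (rule ordLeq_transitive[OF card_of_image card_ran_le_UNIV])
  ultimately show ?case
    by (simp add: ran_map_option_comp perm_formula_Conj)
next
  case (Mod_raw f C)
  let ?g = "\<lambda>\<pi>. map_prod (act_names \<pi>) (map_prod (perm_act T \<pi>) (perm_formula T \<pi>))"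
  have "?g (\<pi> * \<sigma>) z = ?g \<pi> (?g \<sigma> z)" if "z \<in> rcset C" for z
  proof -
    obtain N \<alpha> A where z: "z = (N, \<alpha>, A)" by (cases z) auto
    have "perm_formula T (\<pi> * \<sigma>) A = perm_formula T \<pi> (perm_formula T \<sigma> A)"
      using Mod_raw[of z "(\<alpha>, A)" A] that z by simp
    then show ?thesis
      using \<pi> \<sigma> z by (simp add: A.act_times act_names_image apply_times image_comp)
  qed
  then have "cimage (?g (\<pi> * \<sigma>)) C = cimage (?g \<pi>) (cimage (?g \<sigma>) C)"
    unfolding rcset_inject[symmetric] cimage.rep_eq image_image by (intro image_cong) auto
  then show ?case using \<pi> \<sigma> by (simp add: act_effect_times)
qed (use \<pi> \<sigma> in \<open>simp_all add: act_effect_times P.act_times\<close>)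

text \<open>Raw formulas need not be fixed by the identity, since \<open>perm_formula\<close> replaces the stored
  enumeration of a set of conjuncts by the chosen one.\<close>

definition nominal_formulas :: "('b, 'n, 's, 'p, 'a) formula set" where
  "nominal_formulas =
    {A. perm_formula T 1 A = A \<and> finitely_supported srt (perm_formula T) A}"

lemma nominal_formulas: "nominal_set srt (perm_formula T) nominal_formulas"
proof -
  have "finitely_supported srt (perm_formula T) (perm_formula T \<pi> A)"
    if \<pi>: "\<pi> \<in> perms srt" and A: "finitely_supported srt (perm_formula T) A"
    for \<pi> and A :: "('b, 'n, 's, 'p, 'a) formula"
  proof -
    obtain N where "finite N" "supports srt (perm_formula T) N A"
      using A unfolding finitely_supported_def by blast
    then have "finite (apply \<pi> ` N)" "supports srt (perm_formula T) (apply \<pi> ` N) (perm_formula T \<pi> A)"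
      using \<pi> by (auto intro!: supports_act_if_times perm_formula_times)
    then show ?thesis by (rule finitely_supportedI)
  qed
  then show ?thesis
    unfolding nominal_set_def nominal_formulas_def
    by (auto simp: one_in_perms simp flip: perm_formula_times)
qed

interpretation Fm: nominal srt "perm_formula T" nominal_formulas
  using name_supply_T nominal_formulas by unfold_locales

interpretation AF: nominal srt "act_pair (perm_act T) (perm_formula T)" "UNIV \<times> nominal_formulas"
  using name_supply_T nominal_act_pair[OF A.nominal nominal_formulas] by unfold_locales

text \<open>After removal of \<open>bn T \<alpha>\<close>, these are the names that a renaming of
  bound names has to keep.\<close>

abbreviation supp_mod :: "'a \<Rightarrow> ('b, 'n, 's, 'p, 'a) formula \<Rightarrow> 'n set" where
  "supp_mod \<alpha> A \<equiv> supp srt (act_pair (perm_act T) (perm_formula T)) (\<alpha>, A)"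

lemma perm_formula_Mod:
  assumes \<pi>: "\<pi> \<in> perms srt" and A: "A \<in> nominal_formulas"
  shows "perm_formula T \<pi> (Mod T f \<alpha> A) =
    Mod T (act_effect T \<pi> f) (perm_act T \<pi> \<alpha>) (perm_formula T \<pi> A)"
proof -
  let ?p = "act_pair (perm_act T) (perm_formula T)"
  let ?C = "alpha_class srt ?p (bn T \<alpha>) (\<alpha>, A)"
  have "rcset (acset ?C) = ?C"
    by (rule acset_inverse) (simp add: countable_alpha_class[OF name_supply_T])
  then have "cimage (act_pair act_names ?p \<pi>) (acset ?C) = acset (act_pair act_names ?p \<pi> ` ?C)"
    by (metis cimage.rep_eq rcset_inverse)
  moreover have "act_pair act_names ?p \<pi> ` ?C =
      alpha_class srt ?p (bn T (perm_act T \<pi> \<alpha>)) (perm_act T \<pi> \<alpha>, perm_formula T \<pi> A)"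
    using AF.alpha_class_act[OF \<pi>, of "(\<alpha>, A)"] A by (simp add: bn_act[OF \<pi>] act_pair_def)
  ultimately show ?thesis unfolding Mod_def by (simp add: act_pair_def)
qed

lemma Mod_rename:
  assumes \<pi>: "\<pi> \<in> perms srt" and A: "A \<in> nominal_formulas"
    and fixed: "\<forall>a \<in> supp_mod \<alpha> A - bn T \<alpha>. \<pi> \<langle>$\<rangle> a = a"
  shows "Mod T f (perm_act T \<pi> \<alpha>) (perm_formula T \<pi> A) = Mod T f \<alpha> A"
  using AF.alpha_class_rename[OF \<pi> _ fixed] A
  unfolding Mod_def by (simp add: bn_act[OF \<pi>] act_pair_def)

lemma card_image_less: "|S| <o \<kappa> \<Longrightarrow> |g ` S| <o \<kappa>"
  by (rule ordLeq_ordLess_trans[OF card_of_image])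

lemma card_le_UNIV: "|S| <o \<kappa> \<Longrightarrow> |S| \<le>o |UNIV :: 'k set|"
  by (rule ordLess_Card_order_UNIV[OF card_order])

lemma is_formula_nominal:
  assumes "is_formula T L \<kappa> F A" "F \<in> Pow_fs T \<F>"
  shows "A \<in> nominal_formulas"
  using assms
proof (induction rule: is_formula.induct)
  case (Conj S F)
  have perm: "perm_formula T \<pi> (Conj S) = Conj (act_set (perm_formula T) \<pi> S)" for \<pi>
    using Conj.hyps by (simp add: perm_formula_Conj card_le_UNIV act_set_def)
  have "\<forall>A \<in> S. perm_formula T 1 A = A"
    using Conj unfolding nominal_formulas_def by blast
  then have "perm_formula T 1 (Conj S) = Conj S"
    unfolding perm by (simp add: act_set_def)
  \<comment> \<open>A support of the set \<open>S\<close> supports its conjunction. The supports of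
    the single conjuncts would not do, as their union may be infinite.\<close>
  moreover have "finitely_supported srt (perm_formula T) (Conj S)"
    using Conj.hyps unfolding finitely_supported_def supports_def perm by metis
  ultimately show ?case unfolding nominal_formulas_def by blast
next
  case (Neg F A)
  then have "A \<in> nominal_formulas" by blast
  then have "supports srt (perm_formula T) (supp srt (perm_formula T) A) (Neg A)"
    unfolding supports_def by (simp add: Fm.act_fixed)
  from finitely_supportedI[OF Fm.supp_supports(1)[OF \<open>A \<in> nominal_formulas\<close>] this]
  show ?case
    using \<open>A \<in> nominal_formulas\<close> unfolding nominal_formulas_def by simp
next
  case (Eff_Pred f F \<phi>)
  then have f: "f \<in> \<F>" using Pow_fsD by blast
  have "supports srt (perm_formula T) (supp srt (act_effect T) f \<union> supp srt (perm_pred T) \<phi>)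
      (Eff_Pred f \<phi>)"
    unfolding supports_def using f by (simp add: E.act_fixed P.act_fixed)
  moreover have "finite (supp srt (act_effect T) f \<union> supp srt (perm_pred T) \<phi>)"
    using f by (simp add: E.supp_supports P.supp_supports)
  ultimately show ?case
    using f unfolding nominal_formulas_def finitely_supported_def by auto
next
  case (Mod f F \<alpha> A)
  then have f: "f \<in> \<F>" and A: "A \<in> nominal_formulas"
    using Pow_fsD L_closed by blast+
  let ?N = "supp srt (act_effect T) f \<union> supp_mod \<alpha> A"
  have "supports srt (perm_formula T) ?N (Mod T f \<alpha> A)"
    unfolding supports_def
  proof (intro ballI impI)
    fix \<pi> assume \<pi>: "\<pi> \<in> perms srt" "\<forall>a \<in> ?N. \<pi> \<langle>$\<rangle> a = a"
    have "perm_formula T \<pi> (Mod T f \<alpha> A) = Mod T f (perm_act T \<pi> \<alpha>) (perm_formula T \<pi> A)"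
      using \<pi> f A by (simp add: perm_formula_Mod E.act_fixed)
    also have "\<dots> = Mod T f \<alpha> A"
      using \<pi> A by (intro Mod_rename) auto
    finally show "perm_formula T \<pi> (Mod T f \<alpha> A) = Mod T f \<alpha> A" .
  qed
  moreover have "finite ?N"
    using f A by (simp add: E.supp_supports AF.supp_supports)
  moreover have "perm_formula T 1 (Mod T f \<alpha> A) = Mod T f \<alpha> A"
    using f A by (simp add: perm_formula_Mod one_in_perms)
  ultimately show ?case
    unfolding nominal_formulas_def finitely_supported_def by auto
qed

text \<open>The index set has to move with the formula; under a modality the new index is the right
  one by equivariance of \<open>L\<close>.\<close>

lemma is_formula_act:
  assumes "is_formula T L \<kappa> F A" "F \<in> Pow_fs T \<F>" "\<pi> \<in> perms srt"
  shows "is_formula T L \<kappa> (perm_effects \<pi> F) (perm_formula T \<pi> A)"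
  using assms
proof (induction rule: is_formula.induct)
  case (Conj S F)
  interpret Fs: nominal srt "act_set (perm_formula T)"
    "{S. S \<subseteq> nominal_formulas \<and> finitely_supported srt (act_set (perm_formula T)) S}"
    using name_supply_T nominal_act_set[OF name_supply_T nominal_formulas] by unfold_locales
  have "S \<subseteq> nominal_formulas"
    using Conj is_formula_nominal by blast
  then have "finitely_supported srt (act_set (perm_formula T)) (perm_formula T \<pi> ` S)"
    using Fs.act_closed[OF \<open>\<pi> \<in> perms srt\<close>, of S] Conj.hyps unfolding act_set_def by blast
  moreover have "|perm_formula T \<pi> ` S| <o \<kappa>"
    using \<open>|S| <o \<kappa>\<close> by (rule card_image_less)
  ultimately have "is_formula T L \<kappa> (perm_effects \<pi> F) (Conj (perm_formula T \<pi> ` S))"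
    using Conj by (intro is_formula.Conj) auto
  then show ?case using Conj.hyps by (simp add: perm_formula_Conj card_le_UNIV)
next
  case (Mod f F \<alpha> A)
  then have A: "A \<in> nominal_formulas"
    using L_closed is_formula_nominal by blast
  have "is_formula T L \<kappa> (L (perm_act T \<pi> \<alpha>) (perm_effects \<pi> F) (act_effect T \<pi> f)) (perm_formula T \<pi> A)"
    using Mod L_closed by (simp add: L_act)
  then show ?case
    using Mod A by (simp add: perm_formula_Mod act_effect_mem bn_fresh_act is_formula.Mod)
qed (simp_all add: is_formula.Neg is_formula.Eff_Pred act_effect_mem)

section \<open>Satisfaction of modalities and its equivariance\<close>

lemma satisfies_ModI:
  assumes "A \<in> nominal_formulas"
    and "fresh srt (perm_state T) (bn T \<alpha>) (f P)" "bn_fresh T \<alpha> F f"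
    and "step T (f P) \<alpha> P'" "satisfies T L A (L \<alpha> F f) P'"
  shows "satisfies T L (Mod T f \<alpha> A) F P"
proof -
  have "(bn T \<alpha>, \<alpha>, A) \<in> alpha_class srt (act_pair (perm_act T) (perm_formula T)) (bn T \<alpha>) (\<alpha>, A)"
    using AF.alpha_eq_refl[of "(\<alpha>, A)"] assms(1) unfolding alpha_class_def by simp
  then show ?thesis using assms(2-) unfolding satisfies_Mod[OF name_supply_T] by blast
qed

text \<open>The representative picked by satisfaction is presented as a renaming by
  \<open>\<tau>\<close> of the given one. Both have bound names fresh for F and f, so
  \<open>\<tau>\<close> can be chosen to fix F and f, and then equivariance of \<open>L\<close>
  turns the index at the new label into the \<open>\<tau>\<close>-image of the old index.\<close>

lemma satisfies_ModE:
  assumes F: "F \<in> Pow_fs T \<F>" and f: "f \<in> F" and \<alpha>: "bn_fresh T \<alpha> F f"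
    and A: "A \<in> nominal_formulas" and sat: "satisfies T L (Mod T f \<alpha> A) F P"
  obtains \<tau> P' where "\<tau> \<in> perms srt" "\<forall>a \<in> supp_mod \<alpha> A - bn T \<alpha>. \<tau> \<langle>$\<rangle> a = a"
    "perm_effects \<tau> F = F" "act_effect T \<tau> f = f"
    "fresh srt (perm_state T) (bn T \<alpha>) (f P) \<Longrightarrow> perm_state T \<tau> (f P) = f P"
    "fresh srt (perm_state T) (bn T (perm_act T \<tau> \<alpha>)) (f P)" "bn_fresh T (perm_act T \<tau> \<alpha>) F f"
    "step T (f P) (perm_act T \<tau> \<alpha>) P'"
    "satisfies T L (perm_formula T \<tau> A) (perm_effects \<tau> (L \<alpha> F f)) P'"
proof -
  let ?p = "act_pair (perm_act T) (perm_formula T)"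
  obtain N \<beta> B P' where mem: "(N, \<beta>, B) \<in> alpha_class srt ?p (bn T \<alpha>) (\<alpha>, A)"
    and \<beta>: "fresh srt (perm_state T) (bn T \<beta>) (f P)" "bn_fresh T \<beta> F f"
    and P': "step T (f P) \<beta> P'" "satisfies T L B (L \<beta> F f) P'"
    using sat unfolding satisfies_Mod[OF name_supply_T] by blast
  have N: "N = bn T \<beta>"
    using mem unfolding alpha_class_def alpha_eq_def act_pair_def
    by (auto simp: act_names_image bn_act)
  \<comment> \<open>Subtracting \<open>bn T \<alpha>\<close> makes \<open>?Z\<close> disjoint from
    these bound names in every case. If they are fresh for f(P), nothing is subtracted and
    \<open>\<tau>\<close> fixes f(P) as well.\<close>
  let ?Z = "supp srt perm_effects F \<union> supp srt (act_effect T) f \<union>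
    (supp srt (perm_state T) (f P) - bn T \<alpha>)"
  have Z: "bn T \<alpha> \<inter> ?Z = {}" "N \<inter> ?Z = {}"
    using \<alpha> \<beta> unfolding N bn_fresh_def fresh_def by auto
  have "(\<alpha>, A) \<in> UNIV \<times> nominal_formulas" using A by simp
  from AF.alpha_classE[OF this finite_bn mem Z]
  obtain \<tau> where \<tau>: "\<tau> \<in> perms srt" "(\<beta>, B) = ?p \<tau> (\<alpha>, A)"
    "\<forall>a \<in> supp_mod \<alpha> A - bn T \<alpha>. \<tau> \<langle>$\<rangle> a = a" "\<forall>a \<in> ?Z. \<tau> \<langle>$\<rangle> a = a"
    by metis
  have eq: "\<beta> = perm_act T \<tau> \<alpha>" "B = perm_formula T \<tau> A"
    using \<tau>(2) by (simp_all add: act_pair_def)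
  have \<tau>F: "perm_effects \<tau> F = F"
    using \<tau>(4) by (intro Es.act_fixed[OF \<tau>(1) F]) blast
  have \<tau>f: "act_effect T \<tau> f = f"
    using \<tau>(4) by (intro E.act_fixed[OF \<tau>(1) Pow_fsD[OF F f]]) blast
  have "L \<beta> F f = perm_effects \<tau> (L \<alpha> F f)"
    using L_act[OF \<tau>(1) F f, of \<alpha>] by (simp add: \<tau>F \<tau>f eq)
  moreover have "perm_state T \<tau> (f P) = f P" if "fresh srt (perm_state T) (bn T \<alpha>) (f P)"
    using \<tau>(1,4) that unfolding fresh_def by (intro S.act_fixed) auto
  ultimately show thesis
    using that[OF \<tau>(1,3) \<tau>F \<tau>f] \<beta> P' eq by simp
qed

text \<open>One implication for all copies \<open>\<rho>\<close> is enough for the induction. At a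
  negation the converse is needed, and it is the induction hypothesis for the copy under
  \<open>\<pi> * \<rho>\<close>, moved by \<open>inverse \<pi>\<close>. At a modality the copy under
  \<open>\<tau> * \<rho>\<close> accounts for the representative chosen by satisfaction.\<close>

lemma satisfies_act_forward:
  assumes "is_formula T L \<kappa> F A" "F \<in> Pow_fs T \<F>" "\<rho> \<in> perms srt" "\<pi> \<in> perms srt"
    and "satisfies T L (perm_formula T \<rho> A) (perm_effects \<rho> F) P"
  shows "satisfies T L (perm_formula T \<pi> (perm_formula T \<rho> A)) (perm_effects \<pi> (perm_effects \<rho> F))
    (perm_state T \<pi> P)"
  using assms
proof (induction arbitrary: \<rho> \<pi> P rule: is_formula.induct)
  case (Conj S F)
  have le: "|S| \<le>o |UNIV :: 'k set|" "|perm_formula T \<rho> ` S| \<le>o |UNIV :: 'k set|"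
    "|perm_formula T \<pi> ` perm_formula T \<rho> ` S| \<le>o |UNIV :: 'k set|"
    using \<open>|S| <o \<kappa>\<close> by (intro card_le_UNIV card_image_less; assumption)+
  show ?case
    using Conj unfolding perm_formula_Conj[OF le(1)] perm_formula_Conj[OF le(2)]
      satisfies_Conj[OF le(2)] satisfies_Conj[OF le(3)] by blast
next
  case (Neg F A)
  note \<pi> = \<open>\<pi> \<in> perms srt\<close> and \<rho> = \<open>\<rho> \<in> perms srt\<close> and F = \<open>F \<in> Pow_fs T \<F>\<close>
  let ?A = "perm_formula T \<rho> A" and ?F = "perm_effects \<rho> F"
  have "?A \<in> nominal_formulas" "?F \<in> Pow_fs T \<F>"
    using Neg is_formula_nominal Fm.act_closed Es.act_closed by blast+
  then have inv: "perm_formula T (inverse \<pi>) (perm_formula T (\<pi> * \<rho>) A) = ?A"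
    "perm_effects (inverse \<pi>) (perm_effects (\<pi> * \<rho>) F) = ?F"
    using \<pi> \<rho> F by (simp_all add: perm_formula_times Es.act_times Fm.act_inverse Es.act_inverse)
  have "satisfies T L ?A ?F P"
    if "satisfies T L (perm_formula T \<pi> ?A) (perm_effects \<pi> ?F) (perm_state T \<pi> P)"
  proof -
    have "satisfies T L (perm_formula T (\<pi> * \<rho>) A) (perm_effects (\<pi> * \<rho>) F) (perm_state T \<pi> P)"
      using that \<pi> \<rho> F by (simp add: perm_formula_times Es.act_times)
    from Neg.IH[OF F times_in_perms[OF \<pi> \<rho>] inverse_in_perms[OF \<pi>] this]
    show ?thesis unfolding inv S.act_inverse(1)[OF \<pi> UNIV_I] .
  qed
  then show ?case using Neg.prems by auto
next
  case (Eff_Pred f F \<phi>)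
  then show ?case
    using models_act by (simp add: act_effect_apply)
next
  case (Mod f F \<alpha> A)
  note \<pi> = \<open>\<pi> \<in> perms srt\<close> and \<rho> = \<open>\<rho> \<in> perms srt\<close> and F = \<open>F \<in> Pow_fs T \<F>\<close>
  define F\<^sub>1 f\<^sub>1 \<alpha>\<^sub>1 A\<^sub>1 where "F\<^sub>1 = perm_effects \<rho> F" and "f\<^sub>1 = act_effect T \<rho> f"
    and "\<alpha>\<^sub>1 = perm_act T \<rho> \<alpha>" and "A\<^sub>1 = perm_formula T \<rho> A"
  note defs = this
  have G: "L \<alpha> F f \<in> Pow_fs T \<F>" and A: "A \<in> nominal_formulas"
    using Mod L_closed is_formula_nominal by blast+
  have F\<^sub>1: "F\<^sub>1 \<in> Pow_fs T \<F>" and f\<^sub>1: "f\<^sub>1 \<in> F\<^sub>1" and \<alpha>\<^sub>1: "bn_fresh T \<alpha>\<^sub>1 F\<^sub>1 f\<^sub>1"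
    and A\<^sub>1: "A\<^sub>1 \<in> nominal_formulas"
    using Mod \<rho> A unfolding defs
    by (simp_all add: Es.act_closed act_effect_mem bn_fresh_act Fm.act_closed)
  have "satisfies T L (Mod T f\<^sub>1 \<alpha>\<^sub>1 A\<^sub>1) F\<^sub>1 P"
    using Mod.prems \<rho> A by (simp add: perm_formula_Mod defs)
  from satisfies_ModE[OF F\<^sub>1 f\<^sub>1 \<alpha>\<^sub>1 A\<^sub>1 this]
  obtain \<tau> P' where \<tau>: "\<tau> \<in> perms srt" "\<forall>a \<in> supp_mod \<alpha>\<^sub>1 A\<^sub>1 - bn T \<alpha>\<^sub>1. \<tau> \<langle>$\<rangle> a = a"
    "perm_effects \<tau> F\<^sub>1 = F\<^sub>1" "act_effect T \<tau> f\<^sub>1 = f\<^sub>1"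
    and fresh: "fresh srt (perm_state T) (bn T (perm_act T \<tau> \<alpha>\<^sub>1)) (f\<^sub>1 P)"
      "bn_fresh T (perm_act T \<tau> \<alpha>\<^sub>1) F\<^sub>1 f\<^sub>1"
    and step: "step T (f\<^sub>1 P) (perm_act T \<tau> \<alpha>\<^sub>1) P'"
    and sat: "satisfies T L (perm_formula T \<tau> A\<^sub>1) (perm_effects \<tau> (L \<alpha>\<^sub>1 F\<^sub>1 f\<^sub>1)) P'"
    by metis
  let ?\<beta> = "perm_act T \<tau> \<alpha>\<^sub>1" and ?B = "perm_formula T \<tau> A\<^sub>1"
  have L\<^sub>1: "L \<alpha>\<^sub>1 F\<^sub>1 f\<^sub>1 = perm_effects \<rho> (L \<alpha> F f)"
    using L_act Mod \<rho> unfolding defs by blast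
  have L\<^sub>2: "L ?\<beta> F\<^sub>1 f\<^sub>1 = perm_effects \<tau> (L \<alpha>\<^sub>1 F\<^sub>1 f\<^sub>1)"
    using L_act[OF \<tau>(1) F\<^sub>1 f\<^sub>1] \<tau>(3,4) by simp
  have B: "?B \<in> nominal_formulas" using A\<^sub>1 \<tau>(1) by (simp add: Fm.act_closed)
  have "satisfies T L (perm_formula T (\<tau> * \<rho>) A) (perm_effects (\<tau> * \<rho>) (L \<alpha> F f)) P'"
    using sat G \<rho> \<tau>(1) by (simp add: L\<^sub>1 defs(4) perm_formula_times Es.act_times)
  from Mod.IH[OF G times_in_perms[OF \<tau>(1) \<rho>] \<pi> this]
  have "satisfies T L (perm_formula T \<pi> ?B) (perm_effects \<pi> (L ?\<beta> F\<^sub>1 f\<^sub>1)) (perm_state T \<pi> P')"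
    using G \<rho> \<tau>(1) by (simp add: L\<^sub>1 L\<^sub>2 defs(4) perm_formula_times Es.act_times)
  then have "satisfies T L (Mod T (act_effect T \<pi> f\<^sub>1) (perm_act T \<pi> ?\<beta>) (perm_formula T \<pi> ?B))
      (perm_effects \<pi> F\<^sub>1) (perm_state T \<pi> P)"
    using step_act[OF \<pi> step] fresh \<pi> F\<^sub>1 f\<^sub>1 B
    by (intro satisfies_ModI)
      (simp_all add: Fm.act_closed act_effect_apply bn_act S.fresh_act bn_fresh_act L_act)
  then have "satisfies T L (perm_formula T \<pi> (Mod T f\<^sub>1 ?\<beta> ?B)) (perm_effects \<pi> F\<^sub>1) (perm_state T \<pi> P)"
    using \<pi> B by (simp add: perm_formula_Mod)
  then show ?case
    using Mod_rename[OF \<tau>(1) A\<^sub>1 \<tau>(2)] \<rho> A by (simp add: perm_formula_Mod defs)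
qed

lemma satisfies_act:
  assumes A: "is_formula T L \<kappa> F A" and F: "F \<in> Pow_fs T \<F>" and \<pi>: "\<pi> \<in> perms srt"
  shows "satisfies T L (perm_formula T \<pi> A) (perm_effects \<pi> F) (perm_state T \<pi> P) \<longleftrightarrow>
    satisfies T L A F P"
proof
  have nom: "A \<in> nominal_formulas" using A F by (rule is_formula_nominal)
  show "satisfies T L A F P"
    if "satisfies T L (perm_formula T \<pi> A) (perm_effects \<pi> F) (perm_state T \<pi> P)"
    using satisfies_act_forward[OF A F \<pi> inverse_in_perms[OF \<pi>] that] nom F \<pi>
    by (simp add: Fm.act_inverse Es.act_inverse S.act_inverse)
  show "satisfies T L (perm_formula T \<pi> A) (perm_effects \<pi> F) (perm_state T \<pi> P)"
    if "satisfies T L A F P"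
    using satisfies_act_forward[OF A F one_in_perms \<pi>] nom F that by simp
qed

text \<open>Since \<open>bn T \<alpha>\<close> is fresh for F and f, their supports are among the
  names that need not move. The bound names can thus be made fresh for further finitely many names
  while F and f are kept.\<close>

lemma ex_bn_renaming:
  assumes F: "F \<in> Pow_fs T \<F>" and f: "f \<in> F" and \<alpha>: "bn_fresh T \<alpha> F f" and Y: "finite Y"
  obtains \<pi> where "\<pi> \<in> perms srt" "\<forall>a \<in> Y - bn T \<alpha>. \<pi> \<langle>$\<rangle> a = a"
    "bn T (perm_act T \<pi> \<alpha>) \<inter> Y = {}" "perm_effects \<pi> F = F" "act_effect T \<pi> f = f"
    "bn_fresh T (perm_act T \<pi> \<alpha>) F f"
proof -
  let ?Y = "Y \<union> supp srt perm_effects F \<union> supp srt (act_effect T) f"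
  have "finite ?Y" using F f Y Pow_fsD by (auto simp: Es.supp_supports E.supp_supports)
  from ex_perm_fresh[OF name_supply_T finite_bn this]
  obtain \<pi> where \<pi>: "\<pi> \<in> perms srt" "\<forall>a \<in> bn T \<alpha>. \<pi> \<langle>$\<rangle> a \<notin> ?Y"
    "\<forall>a \<in> ?Y - bn T \<alpha>. \<pi> \<langle>$\<rangle> a = a"
    by blast
  have "perm_effects \<pi> F = F"
    using \<pi>(1,3) \<alpha> F unfolding bn_fresh_def fresh_def by (intro Es.act_fixed) auto
  moreover have "act_effect T \<pi> f = f"
    using \<pi>(1,3) \<alpha> F f Pow_fsD unfolding bn_fresh_def fresh_def by (intro E.act_fixed) auto
  moreover have "bn T (perm_act T \<pi> \<alpha>) \<inter> Y = {}" "bn_fresh T (perm_act T \<pi> \<alpha>) F f"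
    using \<pi>(2) unfolding bn_fresh_def fresh_def bn_act[OF \<pi>(1)] by auto
  ultimately show thesis using that \<pi> by auto
qed


section \<open>L-bisimilarity is logical equivalence\<close>

lemma L_bisimilar_sym:
  assumes "F \<in> Pow_fs T \<F>" "L_bisimilar T \<F> L F P Q"
  shows "L_bisimilar T \<F> L F Q P"
  using assms unfolding L_bisimilar_def L_bisimulation_def by (blast dest: sympD)

lemma L_bisimilar_models:
  assumes "F \<in> Pow_fs T \<F>" "L_bisimilar T \<F> L F P Q" "f \<in> F" "(f P, \<phi>) \<in> models T"
  shows "(f Q, \<phi>) \<in> models T"
  using assms unfolding L_bisimilar_def L_bisimulation_def by blast

lemma L_bisimilar_step:
  assumes "F \<in> Pow_fs T \<F>" "L_bisimilar T \<F> L F P Q" "f \<in> F"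
    and "fresh srt (perm_state T) (bn T \<alpha>) (f Q)" "bn_fresh T \<alpha> F f" "step T (f P) \<alpha> P'"
  obtains Q' where "step T (f Q) \<alpha> Q'" "L_bisimilar T \<F> L (L \<alpha> F f) P' Q'"
proof -
  obtain R where R: "L_bisimulation T \<F> L R" "R F P Q"
    using assms(2) unfolding L_bisimilar_def by blast
  then obtain Q' where "step T (f Q) \<alpha> Q'" "R (L \<alpha> F f) P' Q'"
    using assms(1,3-) unfolding L_bisimulation_def by blast
  then show thesis using that R(1) unfolding L_bisimilar_def by blast
qed

lemma L_bisimilar_satisfies_act:
  assumes "is_formula T L \<kappa> F A" "F \<in> Pow_fs T \<F>" "\<rho> \<in> perms srt"
    and "L_bisimilar T \<F> L (perm_effects \<rho> F) P Q"
    and "satisfies T L (perm_formula T \<rho> A) (perm_effects \<rho> F) P"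
  shows "satisfies T L (perm_formula T \<rho> A) (perm_effects \<rho> F) Q"
  using assms
proof (induction arbitrary: \<rho> P Q rule: is_formula.induct)
  case (Conj S F)
  have le: "|S| \<le>o |UNIV :: 'k set|" "|perm_formula T \<rho> ` S| \<le>o |UNIV :: 'k set|"
    using \<open>|S| <o \<kappa>\<close> by (intro card_le_UNIV card_image_less; assumption)+
  show ?case
    using Conj unfolding perm_formula_Conj[OF le(1)] satisfies_Conj[OF le(2)] by blast
next
  case (Neg F A)
  then have "L_bisimilar T \<F> L (perm_effects \<rho> F) Q P"
    by (blast intro: L_bisimilar_sym Es.act_closed)
  then show ?case using Neg by auto
next
  case (Eff_Pred f F \<phi>)
  then show ?case
    using L_bisimilar_models[OF Es.act_closed] act_effect_mem by simp
next
  case (Mod f F \<alpha> A)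
  note \<rho> = \<open>\<rho> \<in> perms srt\<close> and F = \<open>F \<in> Pow_fs T \<F>\<close>
  define F\<^sub>1 f\<^sub>1 \<alpha>\<^sub>1 A\<^sub>1 where "F\<^sub>1 = perm_effects \<rho> F" and "f\<^sub>1 = act_effect T \<rho> f"
    and "\<alpha>\<^sub>1 = perm_act T \<rho> \<alpha>" and "A\<^sub>1 = perm_formula T \<rho> A"
  note defs = this
  have G: "L \<alpha> F f \<in> Pow_fs T \<F>" and A: "A \<in> nominal_formulas"
    using Mod L_closed is_formula_nominal by blast+
  have F\<^sub>1: "F\<^sub>1 \<in> Pow_fs T \<F>" and f\<^sub>1: "f\<^sub>1 \<in> F\<^sub>1" and \<alpha>\<^sub>1: "bn_fresh T \<alpha>\<^sub>1 F\<^sub>1 f\<^sub>1"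
    and A\<^sub>1: "A\<^sub>1 \<in> nominal_formulas"
    using Mod \<rho> A unfolding defs
    by (simp_all add: Es.act_closed act_effect_mem bn_fresh_act Fm.act_closed)
  have "satisfies T L (Mod T f\<^sub>1 \<alpha>\<^sub>1 A\<^sub>1) F\<^sub>1 P"
    using Mod.prems \<rho> A by (simp add: perm_formula_Mod defs)
  from satisfies_ModE[OF F\<^sub>1 f\<^sub>1 \<alpha>\<^sub>1 A\<^sub>1 this]
  obtain \<tau> P' where \<tau>: "\<tau> \<in> perms srt" "\<forall>a \<in> supp_mod \<alpha>\<^sub>1 A\<^sub>1 - bn T \<alpha>\<^sub>1. \<tau> \<langle>$\<rangle> a = a"
    "perm_effects \<tau> F\<^sub>1 = F\<^sub>1" "act_effect T \<tau> f\<^sub>1 = f\<^sub>1"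
    and \<beta>: "bn_fresh T (perm_act T \<tau> \<alpha>\<^sub>1) F\<^sub>1 f\<^sub>1"
    and step: "step T (f\<^sub>1 P) (perm_act T \<tau> \<alpha>\<^sub>1) P'"
    and sat: "satisfies T L (perm_formula T \<tau> A\<^sub>1) (perm_effects \<tau> (L \<alpha>\<^sub>1 F\<^sub>1 f\<^sub>1)) P'"
    by metis
  let ?\<beta> = "perm_act T \<tau> \<alpha>\<^sub>1" and ?B = "perm_formula T \<tau> A\<^sub>1"
  have B: "?B \<in> nominal_formulas" using A\<^sub>1 \<tau>(1) by (simp add: Fm.act_closed)
  \<comment> \<open>The label \<open>?\<beta>\<close> is fresh for the effect applied to
    \<open>P\<close>, but the bisimulation clause wants freshness for the effect applied to
    \<open>Q\<close>, hence a second renaming. The first two supports are included so that it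
    preserves the transition of \<open>P\<close> and the modality.\<close>
  let ?Y = "supp srt (act_residual T) (?\<beta>, P') \<union> supp_mod ?\<beta> ?B \<union> supp srt (perm_state T) (f\<^sub>1 Q)"
  have "finite ?Y"
    using B by (simp add: AS.supp_supports AF.supp_supports S.supp_supports)
  from ex_bn_renaming[OF F\<^sub>1 f\<^sub>1 \<beta> this]
  obtain \<pi> where \<pi>: "\<pi> \<in> perms srt" "\<forall>a \<in> ?Y - bn T ?\<beta>. \<pi> \<langle>$\<rangle> a = a"
    "bn T (perm_act T \<pi> ?\<beta>) \<inter> ?Y = {}" "perm_effects \<pi> F\<^sub>1 = F\<^sub>1" "act_effect T \<pi> f\<^sub>1 = f\<^sub>1"
    "bn_fresh T (perm_act T \<pi> ?\<beta>) F\<^sub>1 f\<^sub>1"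
    by metis
  let ?\<gamma> = "perm_act T \<pi> ?\<beta>" and ?C = "perm_formula T \<pi> ?B" and ?\<sigma> = "\<pi> * (\<tau> * \<rho>)"
  have \<sigma>: "?\<sigma> \<in> perms srt" using \<pi>(1) \<tau>(1) \<rho> by (simp add: times_in_perms)
  have C: "?C = perm_formula T ?\<sigma> A"
    using \<pi>(1) \<tau>(1) \<rho> by (simp add: defs(4) perm_formula_times times_in_perms)
  have L\<^sub>1: "L \<alpha>\<^sub>1 F\<^sub>1 f\<^sub>1 = perm_effects \<rho> (L \<alpha> F f)"
    using L_act Mod \<rho> unfolding defs by blast
  have L\<^sub>2: "L ?\<beta> F\<^sub>1 f\<^sub>1 = perm_effects \<tau> (L \<alpha>\<^sub>1 F\<^sub>1 f\<^sub>1)"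
    using L_act[OF \<tau>(1) F\<^sub>1 f\<^sub>1] \<tau>(3,4) by simp
  have "L ?\<gamma> F\<^sub>1 f\<^sub>1 = perm_effects \<pi> (L ?\<beta> F\<^sub>1 f\<^sub>1)"
    using L_act[OF \<pi>(1) F\<^sub>1 f\<^sub>1] \<pi>(4,5) by simp
  then have L\<^sub>3: "L ?\<gamma> F\<^sub>1 f\<^sub>1 = perm_effects ?\<sigma> (L \<alpha> F f)"
    using \<pi>(1) \<tau>(1) \<rho> G by (simp add: L\<^sub>1 L\<^sub>2 Es.act_times times_in_perms)
  have "satisfies T L (perm_formula T (\<tau> * \<rho>) A) (perm_effects (\<tau> * \<rho>) (L \<alpha> F f)) P'"
    using sat G \<rho> \<tau>(1) by (simp add: L\<^sub>1 defs(4) perm_formula_times Es.act_times)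
  from satisfies_act_forward[OF Mod.hyps(3) G times_in_perms[OF \<tau>(1) \<rho>] \<pi>(1) this]
  have sat': "satisfies T L (perm_formula T ?\<sigma> A) (perm_effects ?\<sigma> (L \<alpha> F f)) (perm_state T \<pi> P')"
    using G \<rho> \<tau>(1) \<pi>(1) by (simp add: perm_formula_times Es.act_times times_in_perms)
  have "step T (f\<^sub>1 P) ?\<gamma> (perm_state T \<pi> P')"
    using \<pi>(2) by (intro step_rename[OF \<pi>(1) step]) auto
  moreover have fresh: "fresh srt (perm_state T) (bn T ?\<gamma>) (f\<^sub>1 Q)"
    using \<pi>(3) unfolding fresh_def by blast
  moreover have "L_bisimilar T \<F> L F\<^sub>1 P Q"
    using Mod.prems by (simp add: defs)
  ultimately obtain Q' where Q': "step T (f\<^sub>1 Q) ?\<gamma> Q'"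
    "L_bisimilar T \<F> L (L ?\<gamma> F\<^sub>1 f\<^sub>1) (perm_state T \<pi> P') Q'"
    using L_bisimilar_step[OF F\<^sub>1 _ f\<^sub>1 _ \<pi>(6)] by metis
  have "satisfies T L ?C (L ?\<gamma> F\<^sub>1 f\<^sub>1) Q'"
    using Mod.IH[OF G \<sigma> _ sat'] Q'(2) unfolding L\<^sub>3 C by blast
  then have "satisfies T L (Mod T f\<^sub>1 ?\<gamma> ?C) F\<^sub>1 Q"
    using Q'(1) fresh \<pi>(1,6) B by (intro satisfies_ModI) (simp_all add: Fm.act_closed)
  \<comment> \<open>Both renamings are now undone: the modalities built from
    \<open>?\<gamma>\<close>, \<open>?\<beta>\<close> and \<open>\<alpha>\<^sub>1\<close> are the
    same formula.\<close>
  moreover have "Mod T f\<^sub>1 ?\<gamma> ?C = Mod T f\<^sub>1 ?\<beta> ?B"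
    using \<pi>(2) by (intro Mod_rename[OF \<pi>(1) B]) auto
  ultimately show ?case
    using Mod_rename[OF \<tau>(1) A\<^sub>1 \<tau>(2)] \<rho> A by (simp add: perm_formula_Mod defs)
qed

lemma L_bisimilar_satisfies:
  assumes A: "is_formula T L \<kappa> F A" and F: "F \<in> Pow_fs T \<F>" and bisim: "L_bisimilar T \<F> L F P Q"
  shows "satisfies T L A F P \<longleftrightarrow> satisfies T L A F Q"
  using L_bisimilar_satisfies_act[OF A F one_in_perms, of P Q]
    L_bisimilar_satisfies_act[OF A F one_in_perms, of Q P]
    bisim L_bisimilar_sym[OF F bisim] F is_formula_nominal[OF A F] by auto

section \<open>From equal satisfaction to bisimilarity\<close>

abbreviation equivalent :: "'s effect set \<Rightarrow> 's \<Rightarrow> 's \<Rightarrow> bool" where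
  "equivalent F P Q \<equiv> \<forall>A \<in> formulas T L \<kappa> F. satisfies T L A F P \<longleftrightarrow> satisfies T L A F Q"

text \<open>Conjoining the whole orbit of a distinguishing formula under the permutations that fix \<open>P\<close>
  and \<open>F\<close> makes its support independent of \<open>Q\<close>.\<close>

lemma ex_distinguishing_formula:
  assumes F: "F \<in> Pow_fs T \<F>" and "\<not> equivalent F P Q"
  obtains B where "is_formula T L \<kappa> F B" "satisfies T L B F P" "\<not> satisfies T L B F Q"
    "supports srt (perm_formula T) (supp srt (perm_state T) P \<union> supp srt perm_effects F) B"
proof -
  obtain A where A: "is_formula T L \<kappa> F A" "satisfies T L A F P" "\<not> satisfies T L A F Q"
  proof -
    obtain A where "is_formula T L \<kappa> F A" "satisfies T L A F P \<noteq> satisfies T L A F Q"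
      using assms(2) unfolding formulas_def by auto
    then show thesis
      using that[of A] that[of "Neg A"] by (cases "satisfies T L A F P") (auto intro: is_formula.Neg)
  qed
  let ?N = "supp srt (perm_state T) P \<union> supp srt perm_effects F"
  let ?K = "{\<pi> \<in> perms srt. \<forall>a \<in> ?N. \<pi> \<langle>$\<rangle> a = a}"
  let ?S = "(\<lambda>\<pi>. perm_formula T \<pi> A) ` ?K"
  have "countable ?S"
    using name_supply_T countable_subset[OF subset_UNIV countable_perm]
    unfolding name_supply_def by blast
  then have card: "|?S| <o \<kappa>"
    using uncountable ordLeq_ordLess_trans unfolding countable_card_le_natLeq by blast
  then have le: "|?S| \<le>o |UNIV :: 'k set|" by (rule card_le_UNIV)
  have N: "supports srt (act_set (perm_formula T)) ?N ?S"
    unfolding supports_def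
  proof (intro ballI impI)
    have sub: "act_set (perm_formula T) \<pi> ?S \<subseteq> ?S" if "\<pi> \<in> ?K" for \<pi>
    proof -
      have "perm_formula T \<pi> (perm_formula T \<sigma> A) \<in> ?S" if "\<sigma> \<in> ?K" for \<sigma>
      proof -
        have "\<pi> * \<sigma> \<in> ?K"
          using \<open>\<pi> \<in> ?K\<close> that by (simp add: times_in_perms apply_times)
        moreover have "perm_formula T \<pi> (perm_formula T \<sigma> A) = perm_formula T (\<pi> * \<sigma>) A"
          using \<open>\<pi> \<in> ?K\<close> that by (simp add: perm_formula_times)
        ultimately show ?thesis by blast
      qed
      then show ?thesis unfolding act_set_def by blast
    qed
    fix \<pi> assume \<pi>: "\<pi> \<in> perms srt" "\<forall>a \<in> ?N. \<pi> \<langle>$\<rangle> a = a"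
    have inv: "inverse \<pi> \<in> ?K"
      using \<pi> by (auto simp: inverse_in_perms apply_inverse_fixed)
    have "?S \<subseteq> nominal_formulas"
      using is_formula_nominal[OF A(1) F] Fm.act_closed by blast
    \<comment> \<open>The orbit is mapped into itself by \<open>\<pi>\<close> and by its inverse;
      applying \<open>\<pi>\<close> to the second inclusion yields equality.\<close>
    then have "perm_formula T \<pi> ` perm_formula T (inverse \<pi>) ` ?S = ?S"
      using \<pi>(1) by (force simp: image_image Fm.act_inverse)
    then have "?S \<subseteq> act_set (perm_formula T) \<pi> ?S"
      using image_mono[OF sub[OF inv], of "perm_formula T \<pi>"] unfolding act_set_def by metis
    then show "act_set (perm_formula T) \<pi> ?S = ?S"
      using sub[of \<pi>] \<pi> by blast
  qed
  have finite: "finite ?N"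
    using F by (simp add: S.supp_supports Es.supp_supports)
  \<comment> \<open>Permutations in \<open>?K\<close> fix both F and P, so each copy of
    \<open>A\<close> keeps the index F and still holds at P. At Q the conjunction fails because of
    \<open>A\<close> itself, the copy under the identity.\<close>
  have K: "is_formula T L \<kappa> F (perm_formula T \<pi> A) \<and> satisfies T L (perm_formula T \<pi> A) F P"
    if "\<pi> \<in> ?K" for \<pi>
  proof -
    have "perm_effects \<pi> F = F" "perm_state T \<pi> P = P"
      using that F by (simp_all add: Es.act_fixed S.act_fixed)
    then show ?thesis
      using that is_formula_act[OF A(1) F, of \<pi>] satisfies_act[OF A(1) F, of \<pi> P] A(2) by simp
  qed
  have "A \<in> ?S"
    using is_formula_nominal[OF A(1) F] one_in_perms
    by (intro image_eqI[of _ _ 1]) simp_all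
  show thesis
  proof
    show "is_formula T L \<kappa> F (Conj ?S)"
      using K card finitely_supportedI[OF finite N] by (intro is_formula.Conj) blast+
    show "satisfies T L (Conj ?S) F P"
      unfolding satisfies_Conj[OF le] using K by blast
    show "\<not> satisfies T L (Conj ?S) F Q"
      unfolding satisfies_Conj[OF le] using \<open>A \<in> ?S\<close> A(3) by blast
    show "supports srt (perm_formula T) ?N (Conj ?S)"
      using N unfolding supports_def perm_formula_Conj[OF le] act_set_def by simp
  qed
qed

text \<open>The bound names of \<open>\<alpha>\<close> may clash with f(P), as the bisimulation
  clause makes them fresh only for the other state. The transition and the formula are therefore
  renamed together to a representative fresh for f(P), which denotes the same modality.\<close>

lemma satisfies_Mod_step:
  assumes F: "F \<in> Pow_fs T \<F>" and f: "f \<in> F" and \<alpha>: "bn_fresh T \<alpha> F f"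
    and A: "is_formula T L \<kappa> (L \<alpha> F f) A"
    and step: "step T (f P) \<alpha> P'" and sat: "satisfies T L A (L \<alpha> F f) P'"
  shows "satisfies T L (Mod T f \<alpha> A) F P"
proof -
  have G: "L \<alpha> F f \<in> Pow_fs T \<F>" using F f by (rule L_closed)
  have nom: "A \<in> nominal_formulas" using A G by (rule is_formula_nominal)
  let ?Y = "supp srt (act_residual T) (\<alpha>, P') \<union> supp_mod \<alpha> A \<union> supp srt (perm_state T) (f P)"
  have "finite ?Y"
    using nom by (simp add: AS.supp_supports AF.supp_supports S.supp_supports)
  from ex_bn_renaming[OF F f \<alpha> this]
  obtain \<pi> where \<pi>: "\<pi> \<in> perms srt" "\<forall>a \<in> ?Y - bn T \<alpha>. \<pi> \<langle>$\<rangle> a = a"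
    "bn T (perm_act T \<pi> \<alpha>) \<inter> ?Y = {}" "perm_effects \<pi> F = F" "act_effect T \<pi> f = f"
    "bn_fresh T (perm_act T \<pi> \<alpha>) F f"
    by metis
  have "satisfies T L (perm_formula T \<pi> A) (L (perm_act T \<pi> \<alpha>) F f) (perm_state T \<pi> P')"
    using satisfies_act[OF A G \<pi>(1), of P'] sat L_act[OF \<pi>(1) F f, of \<alpha>] \<pi>(4,5) by simp
  moreover have "step T (f P) (perm_act T \<pi> \<alpha>) (perm_state T \<pi> P')"
    using \<pi>(2) by (intro step_rename[OF \<pi>(1) step]) auto
  moreover have "fresh srt (perm_state T) (bn T (perm_act T \<pi> \<alpha>)) (f P)"
    using \<pi>(3) unfolding fresh_def by blast
  ultimately have "satisfies T L (Mod T f (perm_act T \<pi> \<alpha>) (perm_formula T \<pi> A)) F P"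
    using \<pi>(1,6) nom by (intro satisfies_ModI) (simp_all add: Fm.act_closed)
  moreover have "Mod T f (perm_act T \<pi> \<alpha>) (perm_formula T \<pi> A) = Mod T f \<alpha> A"
    using \<pi>(2) by (intro Mod_rename[OF \<pi>(1) nom]) auto
  ultimately show ?thesis by simp
qed

text \<open>Satisfaction provides a transition labelled by some renaming of \<open>\<alpha>\<close>.
  With the bound names of \<open>\<alpha>\<close> fresh for f(P), this renaming fixes f(P), so its
  inverse carries the transition back to one labelled by \<open>\<alpha>\<close> itself.\<close>

lemma satisfies_Mod_fresh:
  assumes F: "F \<in> Pow_fs T \<F>" and f: "f \<in> F" and \<alpha>: "bn_fresh T \<alpha> F f"
    and A: "is_formula T L \<kappa> (L \<alpha> F f) A"
    and fresh: "fresh srt (perm_state T) (bn T \<alpha>) (f P)" and sat: "satisfies T L (Mod T f \<alpha> A) F P"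
  obtains P' where "step T (f P) \<alpha> P'" "satisfies T L A (L \<alpha> F f) P'"
proof -
  have G: "L \<alpha> F f \<in> Pow_fs T \<F>" using F f by (rule L_closed)
  have nom: "A \<in> nominal_formulas" using A G by (rule is_formula_nominal)
  obtain \<tau> P' where \<tau>: "\<tau> \<in> perms srt" "perm_state T \<tau> (f P) = f P"
    "step T (f P) (perm_act T \<tau> \<alpha>) P'"
    "satisfies T L (perm_formula T \<tau> A) (perm_effects \<tau> (L \<alpha> F f)) P'"
    using satisfies_ModE[OF F f \<alpha> nom sat] fresh by metis
  let ?P = "perm_state T (inverse \<tau>) P'"
  have "perm_state T (inverse \<tau>) (f P) = f P"
    using S.act_inverse(1)[OF \<tau>(1), of "f P"] \<tau>(2) by simp
  then have "step T (f P) \<alpha> ?P"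
    using step_act[OF inverse_in_perms[OF \<tau>(1)] \<tau>(3)] \<tau>(1) by (simp add: A.act_inverse)
  moreover have "satisfies T L A (L \<alpha> F f) ?P"
    using satisfies_act[OF A G \<tau>(1), of ?P] \<tau>(1,4) by (simp add: S.act_inverse)
  ultimately show thesis by (rule that)
qed

lemma equivalent_step:
  assumes F: "F \<in> Pow_fs T \<F>" and eq: "equivalent F P Q" and f: "f \<in> F"
    and fresh: "fresh srt (perm_state T) (bn T \<alpha>) (f Q)" and \<alpha>: "bn_fresh T \<alpha> F f"
    and step: "step T (f P) \<alpha> P'"
  shows "\<exists>Q'. step T (f Q) \<alpha> Q' \<and> equivalent (L \<alpha> F f) P' Q'"
proof (rule ccontr)
  let ?G = "L \<alpha> F f"
  let ?N = "supp srt (perm_state T) P' \<union> supp srt perm_effects ?G"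
  assume "\<not> ?thesis"
  then have neq: "\<not> equivalent ?G P' Q'" if "step T (f Q) \<alpha> Q'" for Q'
    using that by blast
  have G: "?G \<in> Pow_fs T \<F>" using F f by (rule L_closed)
  have "\<forall>Q'. \<exists>B. step T (f Q) \<alpha> Q' \<longrightarrow> is_formula T L \<kappa> ?G B \<and> satisfies T L B ?G P' \<and>
      \<not> satisfies T L B ?G Q' \<and> supports srt (perm_formula T) ?N B"
    using ex_distinguishing_formula[OF G neq] by metis
  \<comment> \<open>The choice function need not be finitely supported: all its values at
    derivatives have the common support \<open>?N\<close>, which is enough for the set of them. If
    f(Q) has no such derivative, that set is empty and its conjunction is truth.\<close>
  from choice[OF this] obtain B where B: "\<And>Q'. step T (f Q) \<alpha> Q' \<Longrightarrow>
      is_formula T L \<kappa> ?G (B Q') \<and> satisfies T L (B Q') ?G P' \<and>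
      \<not> satisfies T L (B Q') ?G Q' \<and> supports srt (perm_formula T) ?N (B Q')"
    by blast
  let ?S = "B ` {Q'. step T (f Q) \<alpha> Q'}"
  have "|?S| \<le>o |UNIV :: 's set|"
    by (rule ordLeq_transitive[OF card_of_image card_of_mono1[OF subset_UNIV]])
  then have card: "|?S| <o \<kappa>" using states_less by (rule ordLeq_ordLess_trans)
  then have le: "|?S| \<le>o |UNIV :: 'k set|" by (rule card_le_UNIV)
  have finite: "finite ?N" using G by (simp add: S.supp_supports Es.supp_supports)
  have N: "supports srt (act_set (perm_formula T)) ?N ?S"
    unfolding supports_def
  proof (intro ballI impI)
    fix \<pi> assume "\<pi> \<in> perms srt" "\<forall>a \<in> ?N. \<pi> \<langle>$\<rangle> a = a"
    then have "perm_formula T \<pi> A = A" if "A \<in> ?S" for A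
      using that B unfolding supports_def by blast
    then show "act_set (perm_formula T) \<pi> ?S = ?S" unfolding act_set_def by simp
  qed
  have A: "is_formula T L \<kappa> ?G (Conj ?S)"
    using B card finitely_supportedI[OF finite N] by (intro is_formula.Conj) blast+
  have "satisfies T L (Conj ?S) ?G P'"
    unfolding satisfies_Conj[OF le] using B by blast
  then have "satisfies T L (Mod T f \<alpha> (Conj ?S)) F P"
    by (rule satisfies_Mod_step[OF F f \<alpha> A step])
  then have "satisfies T L (Mod T f \<alpha> (Conj ?S)) F Q"
    using eq is_formula.Mod[OF f \<alpha> A] unfolding formulas_def by blast
  \<comment> \<open>Freshness of \<open>\<alpha>\<close> for f(Q) is used here: the derivative found
    is one for the label \<open>\<alpha>\<close> itself, so the conjunct \<open>B Q'\<close> refutes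
    it.\<close>
  then obtain Q' where "step T (f Q) \<alpha> Q'" "satisfies T L (Conj ?S) ?G Q'"
    using satisfies_Mod_fresh[OF F f \<alpha> A fresh] by blast
  then show False
    unfolding satisfies_Conj[OF le] using B by blast
qed

lemma L_bisimulation_equivalent: "L_bisimulation T \<F> L equivalent"
  unfolding L_bisimulation_def
proof (intro ballI conjI allI impI)
  show "symp (equivalent F)" for F by (rule sympI) simp
  show "(f Q, \<phi>) \<in> models T"
    if "equivalent F P Q" "f \<in> F" "(f P, \<phi>) \<in> models T" for F P Q f \<phi>
    using that(1,3) is_formula.Eff_Pred[OF that(2)] unfolding formulas_def by force
qed (rule equivalent_step)

lemma L_bisimilar_iff_equivalent:
  assumes "F \<in> Pow_fs T \<F>"
  shows "L_bisimilar T \<F> L F P Q \<longleftrightarrow> equivalent F P Q"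
proof
  show "equivalent F P Q" if "L_bisimilar T \<F> L F P Q"
    using L_bisimilar_satisfies[OF _ assms that] unfolding formulas_def by blast
  show "L_bisimilar T \<F> L F P Q" if "equivalent F P Q"
    unfolding L_bisimilar_def using L_bisimulation_equivalent that by blast
qed

end

theorem theorem6p10:
  fixes T :: "('n, 't, 's, 'p, 'a) nts"
    and \<F> :: "'s effect set"
    and L :: "('s, 'a) effect_map"
    and \<kappa> :: "'k rel"
    and F :: "'s effect set"
    and P Q :: 's
  assumes "nominal_transition_system T"
    and "effect_set T \<F>"
    and "equivariant_effect_map T \<F> L"
    and "Card_order \<kappa>" and "natLeq <o \<kappa>" and "|UNIV :: 's set| <o \<kappa>"
    and "F \<in> Pow_fs T \<F>"
  shows "L_bisimilar T \<F> L F P Q \<longleftrightarrow>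
    (\<forall>A \<in> formulas T L \<kappa> F. satisfies T L A F P \<longleftrightarrow> satisfies T L A F Q)"
proof -
  interpret effect_nts T \<F> L \<kappa>
    using assms(1-6) by unfold_locales
  show ?thesis using assms(7) by (rule L_bisimilar_iff_equivalent)
qed

end
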